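(* Let $\mathbf{G}=\{G_n\}_{n=1}^\infty$ be a strongly convergent sequence of finite connected $(X,S)$-graphs with vertex degree bound $d$ and $|V(G_n)|\to\infty$. Let $\mathbf{B}=\{B_n\}_{n=1}^\infty$ be a weakly convergent operator sequence on $\mathbf{G}$ such that every $B_n$ is self-adjoint. Then the normalized spectral distribution functions $N_{B_n}$ converge uniformly on $\mathbb{R}$ as $n\to\infty$.
   Context: $X,S$ are finite sets. An $(X,S)$-graph is a finite simple graph with vertices colored by $X$ and directed edges colored by $S$ (both directions of each edge get a color). **Geometric distance and strong convergence.** The star $S_G(y)$ of a vertex $y$ is the colored graph consisting of $y$, its neighbors, and the edges between $y$ and its neighbors, with inherited colors. For (not necessarily connected) $(X,S)$-graphs $G,H$ on the same finite vertex set $V$, $\delta(G,H)=|\{y\in V: S_G(y)\ne S_H(y)\}|/|V|$, where $S_G(y)=S_H(y)$ means that the stars coincide as colored graphs on the same subset of $V$. For a permutation $\sigma$ of $V$, $H^\sigma$ is the image of the colored graph $H$ under $\sigma$ (edges $(\sigma(x),\sigma(y))$ for $(x,y)\in E(H)$, colors transported). $\delta_s(G,H)=\inf_{\sigma}\delta(G,H^\sigma)$ over all permutations $\sigma$ of $V$. For finite connected $(X,S)$-graphs $G,H$, $\delta_\rho(G,H)=\inf\delta_s(qG,rH)$ over positive integers $q,r$ with $q|V(G)|=r|V(H)|$, where $qG$ is the disjoint union of $q$ copies of $G$, and $qG,rH$ are represented on a common vertex set. A sequence of finite connected $(X,S)$-graphs with degrees $\le d$ is strongly convergent if it is Cauchy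 with respect to $\delta_\rho$. **Weak convergence.** $B_r(x)$ is the subgraph spanned by the vertices at distance $\le r$ from $x$, rooted at $x$. $\mathcal{A}(d,r,X,S)$ is the finite set of rooted color-preserving isomorphism classes of connected rooted $(X,S)$-graphs with degrees $\le d$ and all vertices at distance $\le r$ from the root. $p_G(\alpha)$ is the proportion of vertices $z$ of $G$ such that $B_r(z)$ represents $\alpha$. A sequence with $|V(G_n)|\to\infty$ is weakly convergent if $\lim_np_{G_n}(\alpha)$ exists for all $r\ge1$, $\alpha\in\mathcal{A}(d,r,X,S)$; strongly convergent sequences with degrees $\le d$ and $|V(G_n)|\to\infty$ are weakly convergent. **Weakly convergent operator sequences.** An invariant function on $\alpha$ is a real function on the vertices of a representative of $\alpha$ invariant under its rooted colored automorphisms. A sequence of kernels $\mathbf{A}=\{A_n:V(G_n)\times V(G_n)\to\mathbb{R}\}$ (acting by $A_nf(x)=\sum_yA_n(x,y)f(y)$) is a weakly convergent operator sequence on $\mathbf{G}$ if (i) there is $m_{\mathbf{A}}>0$ with $|A_n(x,y)|\le m_{\mathbf{A}}$ for all $n,x,y$; (ii) there is $s_{\mathbf{A}}>0$ with $A_n(x,y)=0$ whenever $d_{G_n}(x,y)>s_{\mathbf{A}}$; (iii) for the same $s_{\mathbf{A}}$, for every $\alpha\in\mathcal{A}(d,s_{\mathbf{A}},X,S)$ with $\lim_np_{G_n}(\alpha)\ne0$ there is an invariant function $f^{\mathbf{A}}_\alpha$ on $\alpha$ such that for all $n$ and $x\in V(G_n)$, if $B_{s_{\mathbf{A}}}(x)$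 represents $\alpha$ then $A_n(x,\cdot)$ on $B_{s_{\mathbf{A}}}(x)$ corresponds to $f^{\mathbf{A}}_\alpha$. **Spectral distribution.** $N_{B_n}(\lambda)$ is the number of eigenvalues of $B_n$ (with multiplicity) not larger than $\lambda$, divided by $|V(G_n)|$. *)

theory Defs
  imports
    "HOL-Analysis.Uniform_Limit"
    "HOL-Combinatorics.Permutations"
    "HOL-Library.Extended_Nat"
    "Graph_Theory.Graph_Theory"
    "Jordan_Normal_Form.Char_Poly"
begin

section \<open>Coloured graphs\<close>

text \<open>
  The underlying finite simple graph is a symmetric loop-free digraph, so that the two directions
  of an edge carry independent colours. The colour functions are total; only their values on
  vertices and arcs are meaningful.
\<close>

record ('v, 'x, 's) cgraph =
  ugraph :: "'v pair_pre_digraph"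
  vcol :: "'v \<Rightarrow> 'x"
  ecol :: "'v \<times> 'v \<Rightarrow> 's"

abbreviation V :: "('v, 'x, 's) cgraph \<Rightarrow> 'v set" where
  "V G \<equiv> pverts (ugraph G)"

abbreviation E :: "('v, 'x, 's) cgraph \<Rightarrow> ('v \<times> 'v) set" where
  "E G \<equiv> parcs (ugraph G)"

definition xs_graph :: "'x set \<Rightarrow> 's set \<Rightarrow> ('v, 'x, 's) cgraph \<Rightarrow> bool" where
  "xs_graph X S G \<longleftrightarrow>
     pair_graph (ugraph G) \<and> (\<forall>v\<in>V G. vcol G v \<in> X) \<and> (\<forall>e\<in>E G. ecol G e \<in> S)"

text \<open>For symmetric graphs strong connectedness is connectedness (including non-emptiness).\<close>

definition conn :: "('v, 'x, 's) cgraph \<Rightarrow> bool" where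
  "conn G \<longleftrightarrow> strongly_connected (with_proj (ugraph G))"

definition deg_le :: "nat \<Rightarrow> ('v, 'x, 's) cgraph \<Rightarrow> bool" where
  "deg_le d G \<longleftrightarrow> (\<forall>v\<in>V G. out_degree (with_proj (ugraph G)) v \<le> d)"

definition gdist :: "('v, 'x, 's) cgraph \<Rightarrow> 'v \<Rightarrow> 'v \<Rightarrow> enat" where
  "gdist G x y =
     (INF p\<in>{p. pre_digraph.awalk (with_proj (ugraph G)) x p y}. enat (length p))"

text \<open>Equality of coloured graphs as such, i.e. disregarding colours outside vertices and arcs.\<close>

definition same_cgraph :: "('v, 'x, 's) cgraph \<Rightarrow> ('v, 'x, 's) cgraph \<Rightarrow> bool" where
  "same_cgraph G H \<longleftrightarrow>
     V G = V H \<and> E G = E H \<and>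
     (\<forall>v\<in>V G. vcol G v = vcol H v) \<and> (\<forall>e\<in>E G. ecol G e = ecol H e)"


section \<open>Geometric distance and strong convergence\<close>

definition star :: "('v, 'x, 's) cgraph \<Rightarrow> 'v \<Rightarrow> ('v, 'x, 's) cgraph" where
  "star G y = G \<lparr> ugraph :=
     \<lparr> pverts = insert y {z. (y, z) \<in> E G},
       parcs = {(u, v) \<in> E G. u = y \<or> v = y} \<rparr> \<rparr>"

definition delta :: "('v, 'x, 's) cgraph \<Rightarrow> ('v, 'x, 's) cgraph \<Rightarrow> real" where
  "delta G H = real (card {y \<in> V G. \<not> same_cgraph (star G y) (star H y)}) / real (card (V G))"

text \<open>The image of a coloured graph under a map that is injective on its vertices.\<close>

definition image_cgraph :: "('v \<Rightarrow> 'w) \<Rightarrow> ('v, 'x, 's) cgraph \<Rightarrow> ('w, 'x, 's) cgraph" where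
  "image_cgraph \<phi> G =
     \<lparr> ugraph = \<lparr> pverts = \<phi> ` V G, parcs = map_prod \<phi> \<phi> ` E G \<rparr>,
       vcol = (\<lambda>a. vcol G (the_inv_into (V G) \<phi> a)),
       ecol = (\<lambda>(a, b). ecol G (the_inv_into (V G) \<phi> a, the_inv_into (V G) \<phi> b)) \<rparr>"

definition delta_s :: "('v, 'x, 's) cgraph \<Rightarrow> ('v, 'x, 's) cgraph \<Rightarrow> real" where
  "delta_s G H = Inf {delta G (image_cgraph \<sigma> H) | \<sigma>. \<sigma> permutes V G}"

definition copies :: "nat \<Rightarrow> ('v, 'x, 's) cgraph \<Rightarrow> ('v \<times> nat, 'x, 's) cgraph" where
  "copies q G =
     \<lparr> ugraph = \<lparr> pverts = V G \<times> {..<q},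
                  parcs = {((u, i), (v, i)) | u v i. (u, v) \<in> E G \<and> i < q} \<rparr>,
       vcol = (\<lambda>(u, i). vcol G u),
       ecol = (\<lambda>((u, i), (v, j)). ecol G (u, v)) \<rparr>"

text \<open>
  The common vertex set on which \<open>q\<close> copies of \<open>G\<close> and \<open>r\<close> copies of \<open>H\<close> are represented is
  \<open>{..<q * card (V G)}\<close>. Since \<^const>\<open>delta_s\<close> does not depend on how this is done, the infimum
  ranges over all such representations.
\<close>

definition delta_rho :: "('v, 'x, 's) cgraph \<Rightarrow> ('w, 'x, 's) cgraph \<Rightarrow> real" where
  "delta_rho G H = Inf {delta_s (image_cgraph \<phi> (copies q G)) (image_cgraph \<psi> (copies r H)) | q r \<phi> \<psi>.
     0 < q \<and> 0 < r \<and> q * card (V G) = r * card (V H) \<and>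
     bij_betw \<phi> (V (copies q G)) {..<q * card (V G)} \<and>
     bij_betw \<psi> (V (copies r H)) {..<q * card (V G)}}"

definition strongly_convergent :: "(nat \<Rightarrow> ('v, 'x, 's) cgraph) \<Rightarrow> bool" where
  "strongly_convergent G \<longleftrightarrow> (\<forall>\<epsilon>>0. \<exists>N. \<forall>m\<ge>N. \<forall>n\<ge>N. delta_rho (G m) (G n) < \<epsilon>)"


section \<open>Rooted balls and their frequencies\<close>

type_synonym ('v, 'x, 's) rooted = "('v, 'x, 's) cgraph \<times> 'v"

definition rooted_iso ::
  "('v \<Rightarrow> 'w) \<Rightarrow> ('v, 'x, 's) rooted \<Rightarrow> ('w, 'x, 's) rooted \<Rightarrow> bool" where
  "rooted_iso \<phi> \<alpha> \<beta> \<longleftrightarrow>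
     (let G = fst \<alpha>; H = fst \<beta> in
       bij_betw \<phi> (V G) (V H) \<and> \<phi> (snd \<alpha>) = snd \<beta> \<and>
       (\<forall>u\<in>V G. \<forall>v\<in>V G. (u, v) \<in> E G \<longleftrightarrow> (\<phi> u, \<phi> v) \<in> E H) \<and>
       (\<forall>u\<in>V G. vcol H (\<phi> u) = vcol G u) \<and>
       (\<forall>(u, v)\<in>E G. ecol H (\<phi> u, \<phi> v) = ecol G (u, v)))"

definition gball :: "('v, 'x, 's) cgraph \<Rightarrow> nat \<Rightarrow> 'v \<Rightarrow> ('v, 'x, 's) rooted" where
  "gball G r x =
     (let W = {y \<in> V G. gdist G x y \<le> enat r}
      in (G \<lparr> ugraph := \<lparr> pverts = W, parcs = E G \<inter> W \<times> W \<rparr> \<rparr>, x))"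

text \<open>
  Isomorphism classes are handled through their representatives on sets of natural numbers (every
  class has one); everything below that depends on \<open>\<alpha>\<close> is invariant under rooted isomorphism.
\<close>

definition ball_types :: "nat \<Rightarrow> nat \<Rightarrow> 'x set \<Rightarrow> 's set \<Rightarrow> (nat, 'x, 's) rooted set" where
  "ball_types d r X S = {(H, z). xs_graph X S H \<and> conn H \<and> deg_le d H \<and> z \<in> V H \<and>
     (\<forall>y\<in>V H. gdist H z y \<le> enat r)}"

definition ball_freq :: "('v, 'x, 's) cgraph \<Rightarrow> nat \<Rightarrow> (nat, 'x, 's) rooted \<Rightarrow> real" where
  "ball_freq G r \<alpha> = real (card {z \<in> V G. \<exists>\<phi>. rooted_iso \<phi> \<alpha> (gball G r z)}) / real (card (V G))"


section \<open>Operator sequences\<close>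

definition invariant_function :: "(nat, 'x, 's) rooted \<Rightarrow> (nat \<Rightarrow> real) \<Rightarrow> bool" where
  "invariant_function \<alpha> f \<longleftrightarrow> (\<forall>\<theta>. rooted_iso \<theta> \<alpha> \<alpha> \<longrightarrow> (\<forall>v\<in>V (fst \<alpha>). f (\<theta> v) = f v))"

text \<open>
  By invariance of \<open>f\<close> it is immaterial through which isomorphism \<open>\<phi>\<close> the ball is identified
  with \<open>\<alpha>\<close>.
\<close>

definition weakly_convergent_operators ::
  "nat \<Rightarrow> 'x set \<Rightarrow> 's set \<Rightarrow> (nat \<Rightarrow> ('v, 'x, 's) cgraph) \<Rightarrow> (nat \<Rightarrow> 'v \<Rightarrow> 'v \<Rightarrow> real) \<Rightarrow> bool" where
  "weakly_convergent_operators d X S G A \<longleftrightarrow>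
     (\<exists>m>0. \<forall>n. \<forall>x\<in>V (G n). \<forall>y\<in>V (G n). \<bar>A n x y\<bar> \<le> m) \<and>
     (\<exists>s>0.
       (\<forall>n. \<forall>x\<in>V (G n). \<forall>y\<in>V (G n). gdist (G n) x y > enat s \<longrightarrow> A n x y = 0) \<and>
       (\<forall>\<alpha>\<in>ball_types d s X S. \<forall>L. (\<lambda>n. ball_freq (G n) s \<alpha>) \<longlonglongrightarrow> L \<and> L \<noteq> 0 \<longrightarrow>
         (\<exists>f. invariant_function \<alpha> f \<and>
           (\<forall>n. \<forall>x\<in>V (G n). \<forall>\<phi>. rooted_iso \<phi> \<alpha> (gball (G n) s x) \<longrightarrow>
              (\<forall>v\<in>V (fst \<alpha>). A n x (\<phi> v) = f v)))))"

definition kernel_op :: "'v set \<Rightarrow> ('v \<Rightarrow> 'v \<Rightarrow> real) \<Rightarrow> ('v \<Rightarrow> real) \<Rightarrow> 'v \<Rightarrow> real" where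
  "kernel_op W A f x = (\<Sum>y\<in>W. A x y * f y)"

definition self_adjoint_on :: "'v set \<Rightarrow> ('v \<Rightarrow> 'v \<Rightarrow> real) \<Rightarrow> bool" where
  "self_adjoint_on W A \<longleftrightarrow>
     (\<forall>f g. (\<Sum>x\<in>W. kernel_op W A f x * g x) = (\<Sum>x\<in>W. f x * kernel_op W A g x))"

text \<open>
  The matrix of \<^const>\<open>kernel_op\<close> in the basis of point indicator functions, for some enumeration
  of the finite set \<open>W\<close>; another enumeration yields a similar matrix.
\<close>

definition kernel_mat :: "'v set \<Rightarrow> ('v \<Rightarrow> 'v \<Rightarrow> real) \<Rightarrow> real mat" where
  "kernel_mat W A =
     (let xs = (SOME xs. distinct xs \<and> set xs = W)
      in mat (card W) (card W) (\<lambda>(i, j). A (xs ! i) (xs ! j)))"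

text \<open>
  Eigenvalues are counted with algebraic multiplicity; for self-adjoint kernels all eigenvalues are
  real and this is the dimension of the eigenspace.
\<close>

definition spectral_distribution :: "'v set \<Rightarrow> ('v \<Rightarrow> 'v \<Rightarrow> real) \<Rightarrow> real \<Rightarrow> real" where
  "spectral_distribution W A t =
     real (\<Sum>\<mu> | eigenvalue (kernel_mat W A) \<mu> \<and> \<mu> \<le> t. order \<mu> (char_poly (kernel_mat W A)))
       / real (card W)"

end

theory Submission
  imports Defs "HOL-Analysis.Function_Topology"
begin

text \<open>
  The spectral distributions form a uniform Cauchy sequence. For large \<open>m\<close> and \<open>n\<close> the geometric
  distance of the graphs \<open>G m\<close> and \<open>G n\<close> is small, so suitable numbers of disjoint copies of them live
  on a common finite vertex set \<open>W\<close> in such a way that all but a small fraction of the stars agree.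
  By the degree bound, all but a small fraction of the vertices of \<open>W\<close> then have the same ball of
  radius \<open>s\<close> in both graphs, where \<open>s\<close> is the range of the operators
  (\<open>delta_rho_less_imp_ball_matching\<close>).

  This has two consequences. First, the frequency of every ball type converges
  (\<open>strongly_convergent_imp_convergent_ball_freq\<close>), and all but a small fraction of the vertices have a
  ball type of nonzero limit frequency (\<open>exists_typical_ball_types\<close>). Secondly, over such a ball
  type the rows of both operators are given by one and the same function, so that the rows of the
  copied operators on \<open>W\<close> agree outside a small fraction of \<open>W\<close> (\<open>copied_kernels_agree\<close>).

  Passing to disjoint copies does not affect the normalised spectral distribution, and two self-adjoint
  kernels on \<open>W\<close> whose rows agree outside a set \<open>R\<close> have, for each \<open>t\<close>, numbers of eigenvalues up to
  \<open>t\<close> that differ by at most \<open>card R\<close> (\<open>eigenvalue_count_le\<close>, \<open>spectral_distribution_le\<close>). This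
  estimate does not depend on \<open>t\<close>, whence the uniformity. The comparison of eigenvalue counts rests on
  the spectral theorem for self-adjoint kernels (\<open>spectral_theorem_kernel\<close>).
\<close>

section \<open>Homogeneous linear systems\<close>

lemma homogeneous_system_nontrivial_solution:
  fixes M :: "'j \<Rightarrow> 'i \<Rightarrow> real"
  assumes "finite J" "finite I" "card J < card I"
  shows "\<exists>c. (\<exists>i\<in>I. c i \<noteq> 0) \<and> (\<forall>j\<in>J. (\<Sum>i\<in>I. M j i * c i) = 0)"
  using assms
proof (induction J arbitrary: I M rule: finite_induct)
  case empty
  then have "I \<noteq> {}" by auto
  then show ?case by (intro exI[of _ "\<lambda>_. 1"]) auto
next
  case (insert j J)
  show ?case
  proof (cases "\<forall>i\<in>I. M j i = 0")
    case True
    have "card J < card I" using insert by simp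
    from insert.IH[OF insert.prems(1) this, of M] obtain c where
      "\<exists>i\<in>I. c i \<noteq> 0" "\<forall>j\<in>J. (\<Sum>i\<in>I. M j i * c i) = 0" by blast
    with True show ?thesis by (intro exI[of _ c]) auto
  next
    case False
    then obtain k where k: "k \<in> I" "M j k \<noteq> 0" by blast
    let ?I = "I - {k}"
    \<comment> \<open>Eliminate the unknown \<open>k\<close> by means of the equation \<open>j\<close>.\<close>
    let ?M = "\<lambda>j' i. M j' i - M j' k * M j i / M j k"
    have "card J < card ?I" "finite ?I" using insert k by auto
    from insert.IH[OF this(2,1), of ?M] obtain c where
      c: "\<exists>i\<in>?I. c i \<noteq> 0" "\<And>j'. j' \<in> J \<Longrightarrow> (\<Sum>i\<in>?I. ?M j' i * c i) = 0" by blast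
    define s where "s = (\<Sum>i\<in>?I. M j i * c i)"
    define c' where "c' = c(k := - s / M j k)"
    have split: "(\<Sum>i\<in>I. M j' i * c' i) = (\<Sum>i\<in>?I. M j' i * c i) - M j' k * s / M j k" for j'
    proof -
      have "(\<Sum>i\<in>I. M j' i * c' i) = M j' k * c' k + (\<Sum>i\<in>?I. M j' i * c' i)"
        using insert.prems(1) k(1) by (rule sum.remove)
      also have "(\<Sum>i\<in>?I. M j' i * c' i) = (\<Sum>i\<in>?I. M j' i * c i)"
        by (rule sum.cong) (auto simp: c'_def)
      finally show ?thesis by (simp add: c'_def)
    qed
    have "(\<Sum>i\<in>I. M j i * c' i) = 0"
      using k by (simp add: split s_def)
    moreover have "(\<Sum>i\<in>I. M j' i * c' i) = 0" if "j' \<in> J" for j'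
    proof -
      have "0 = (\<Sum>i\<in>?I. M j' i * c i - M j' k / M j k * (M j i * c i))"
        using c(2)[OF that] by (simp add: algebra_simps)
      also have "\<dots> = (\<Sum>i\<in>?I. M j' i * c i) - M j' k / M j k * s"
        by (simp add: s_def sum_subtractf sum_distrib_left)
      finally show ?thesis by (simp add: split)
    qed
    moreover have "\<exists>i\<in>I. c' i \<noteq> 0" using c(1) by (auto simp: c'_def)
    ultimately show ?thesis by blast
  qed
qed

section \<open>Self-adjoint kernels on a finite set\<close>

text \<open>The inner product of real functions on the finite set \<open>W\<close>.\<close>

definition inner_on :: "'v set \<Rightarrow> ('v \<Rightarrow> real) \<Rightarrow> ('v \<Rightarrow> real) \<Rightarrow> real" where
  "inner_on W f g = (\<Sum>x\<in>W. f x * g x)"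

text \<open>
  An orthonormal family, indexed by \<open>I\<close>, of eigenfunctions \<open>e i\<close> of the kernel \<open>A\<close> for the
  eigenvalues \<open>l i\<close>, with as many members as \<open>W\<close> has points. Functions on \<open>W\<close> are total, and only
  their values on \<open>W\<close> matter.
\<close>

definition eigensystem ::
  "'v set \<Rightarrow> ('v \<Rightarrow> 'v \<Rightarrow> real) \<Rightarrow> 'i set \<Rightarrow> ('i \<Rightarrow> 'v \<Rightarrow> real) \<Rightarrow> ('i \<Rightarrow> real) \<Rightarrow> bool" where
  "eigensystem W A I e l \<longleftrightarrow> finite I \<and> card I = card W \<and>
     (\<forall>i\<in>I. \<forall>j\<in>I. inner_on W (e i) (e j) = (if i = j then 1 else 0)) \<and>
     (\<forall>i\<in>I. \<forall>x\<in>W. kernel_op W A (e i) x = l i * e i x)"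

lemma inner_on_commute: "inner_on W f g = inner_on W g f"
  by (simp add: inner_on_def mult.commute)

lemma inner_on_cong: "(\<And>x. x \<in> W \<Longrightarrow> f x = f' x) \<Longrightarrow> (\<And>x. x \<in> W \<Longrightarrow> g x = g' x) \<Longrightarrow> inner_on W f g = inner_on W f' g'"
  unfolding inner_on_def by (rule sum.cong) auto

lemma inner_on_add_right: "inner_on W f (\<lambda>x. g x + h x) = inner_on W f g + inner_on W f h"
  by (simp add: inner_on_def distrib_left sum.distrib)

lemma inner_on_add_left: "inner_on W (\<lambda>x. g x + h x) f = inner_on W g f + inner_on W h f"
  by (simp add: inner_on_def distrib_right sum.distrib)

lemma inner_on_diff_right: "inner_on W f (\<lambda>x. g x - h x) = inner_on W f g - inner_on W f h"
  by (simp add: inner_on_def right_diff_distrib sum_subtractf)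

lemma inner_on_scale_right: "inner_on W f (\<lambda>x. c * g x) = c * inner_on W f g"
  by (simp add: inner_on_def sum_distrib_left mult.left_commute)

lemma inner_on_scale_left: "inner_on W (\<lambda>x. c * g x) f = c * inner_on W g f"
  by (simp add: inner_on_def sum_distrib_left mult.assoc)

lemma inner_on_sum_right: "inner_on W f (\<lambda>x. \<Sum>i\<in>I. c i * g i x) = (\<Sum>i\<in>I. c i * inner_on W f (g i))"
proof -
  have "inner_on W f (\<lambda>x. \<Sum>i\<in>I. c i * g i x) = (\<Sum>x\<in>W. \<Sum>i\<in>I. c i * (f x * g i x))"
    by (simp add: inner_on_def sum_distrib_left mult.left_commute)
  also have "\<dots> = (\<Sum>i\<in>I. \<Sum>x\<in>W. c i * (f x * g i x))" by (rule sum.swap)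
  finally show ?thesis by (simp add: inner_on_def sum_distrib_left)
qed

lemma inner_on_self_nonneg: "0 \<le> inner_on W f f"
  by (simp add: inner_on_def sum_nonneg)

lemma inner_on_self_eq_0: "finite W \<Longrightarrow> inner_on W f f = 0 \<longleftrightarrow> (\<forall>x\<in>W. f x = 0)"
  by (simp add: inner_on_def sum_nonneg_eq_0_iff)

lemma kernel_op_cong: "(\<And>x. x \<in> W \<Longrightarrow> f x = f' x) \<Longrightarrow> kernel_op W A f x = kernel_op W A f' x"
  unfolding kernel_op_def by (rule sum.cong) auto

lemma kernel_op_add: "kernel_op W A (\<lambda>x. f x + g x) y = kernel_op W A f y + kernel_op W A g y"
  by (simp add: kernel_op_def distrib_left sum.distrib)

lemma kernel_op_scale: "kernel_op W A (\<lambda>x. c * f x) y = c * kernel_op W A f y"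
  by (simp add: kernel_op_def sum_distrib_left mult.left_commute)

lemma kernel_op_sum:
  "kernel_op W A (\<lambda>x. \<Sum>i\<in>I. c i * g i x) y = (\<Sum>i\<in>I. c i * kernel_op W A (g i) y)"
  using inner_on_sum_right[of W "A y" c g I] by (simp add: kernel_op_def inner_on_def)

lemma self_adjoint_inner_on:
  "self_adjoint_on W A \<Longrightarrow> inner_on W (kernel_op W A f) g = inner_on W f (kernel_op W A g)"
  by (simp add: self_adjoint_on_def inner_on_def)

text \<open>The first order condition at a maximum, in the form in which it is used for Rayleigh quotients.\<close>

lemma linear_le_quadratic_imp_zero:
  fixes a C :: real
  assumes "\<And>\<tau>. \<tau> * a \<le> \<tau>\<^sup>2 * C"
  shows "a = 0"
proof (rule ccontr)
  assume "a \<noteq> 0"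
  define D where "D = \<bar>C\<bar> + 1"
  have "D > 0" by (simp add: D_def)
  have "a / D * a \<le> (a / D)\<^sup>2 * C" by (rule assms)
  then have "a\<^sup>2 * D \<le> a\<^sup>2 * C"
    using \<open>D > 0\<close> by (simp add: field_simps power2_eq_square)
  then have "D \<le> C" using \<open>a \<noteq> 0\<close> by simp
  then show False by (simp add: D_def)
qed

text \<open>
  The Rayleigh quotient attains its maximum on the unit sphere of the orthogonal complement of
  fewer than \<open>card W\<close> eigenfunctions, and a maximiser is a further eigenfunction.
\<close>

lemma extend_eigenfunctions:
  fixes A :: "'v \<Rightarrow> 'v \<Rightarrow> real"
  assumes fin: "finite W" and sa: "self_adjoint_on W A" and k: "k < card W"
    and eig: "\<And>i x. i < k \<Longrightarrow> x \<in> W \<Longrightarrow> kernel_op W A (e i) x = l i * e i x"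
  shows "\<exists>f \<mu>. inner_on W f f = 1 \<and> (\<forall>i<k. inner_on W (e i) f = 0) \<and>
    (\<forall>x\<in>W. kernel_op W A f x = \<mu> * f x)"
proof -
  \<comment> \<open>Compactness is that of a product of intervals. Every element of \<open>U\<close> that does not
      vanish on \<open>W\<close> agrees there with a positive multiple of an element of \<open>K\<close>, so the maximum of the
      quadratic form \<open>Q\<close> on \<open>K\<close> bounds the Rayleigh quotient on \<open>U\<close>.\<close>
  define U where "U = {f. \<forall>i<k. inner_on W (e i) f = 0}"
  define Q where "Q f = inner_on W (kernel_op W A f) f" for f
  define Box where "Box = PiE UNIV (\<lambda>x. if x \<in> W then {-1..1::real} else {0})"
  define K where "K = Box \<inter> ({f. inner_on W f f = 1} \<inter> U)"
  have coord: "continuous_on UNIV (\<lambda>f::'v \<Rightarrow> real. f x)" for x by simp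
  have cont: "continuous_on UNIV (\<lambda>f. inner_on W (g f) (h f))"
    if "\<And>x. continuous_on UNIV (\<lambda>f. g f x)" "\<And>x. continuous_on UNIV (\<lambda>f. h f x)"
    for g h :: "('v \<Rightarrow> real) \<Rightarrow> 'v \<Rightarrow> real"
    unfolding inner_on_def by (intro continuous_intros that)
  have "compact Box"
    using compactin_PiE[of "\<lambda>_. euclidean" UNIV "\<lambda>x. if x \<in> W then {-1..1::real} else {0}"]
    by (simp add: Box_def euclidean_product_topology)
  moreover have "closed {f. inner_on W f f = 1}"
    by (intro closed_Collect_eq cont coord continuous_on_const)
  moreover have "closed U"
  proof -
    have "U = (\<Inter>i\<in>{..<k}. {f. inner_on W (e i) f = 0})" by (auto simp: U_def)
    moreover have "closed {f. inner_on W (e i) f = 0}" for i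
      by (intro closed_Collect_eq cont coord continuous_on_const)
    ultimately show ?thesis by (simp add: closed_INT)
  qed
  ultimately have cK: "compact K"
    unfolding K_def by (intro compact_Int_closed closed_Int)
  have normalize: "\<exists>f'\<in>K. \<exists>r>0. \<forall>x\<in>W. f x = r * f' x" if f: "f \<in> U" "inner_on W f f \<noteq> 0" for f
  proof -
    have pos: "inner_on W f f > 0" using inner_on_self_nonneg[of W f] f by linarith
    define r where "r = sqrt (inner_on W f f)"
    have r: "r > 0" "r * r = inner_on W f f" using pos by (auto simp: r_def)
    define f' where "f' x = (if x \<in> W then (1 / r) * f x else 0)" for x
    have 1: "inner_on W g f' = (1 / r) * inner_on W g f" for g
      unfolding inner_on_scale_right[symmetric] by (rule inner_on_cong) (auto simp: f'_def)
    have "inner_on W f' f' = (1 / r) * inner_on W f f'" using 1[of f'] inner_on_commute[of W f' f] by simp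
    then have 2: "inner_on W f' f' = 1" using r pos by (simp add: 1[of f] field_simps)
    have "f' \<in> Box"
    proof -
      have "\<bar>f' x\<bar> \<le> 1" if "x \<in> W" for x
      proof -
        have "f' x * f' x \<le> inner_on W f' f'"
          unfolding inner_on_def using fin that by (intro member_le_sum) auto
        then show ?thesis using 2 by (simp add: abs_le_square_iff power2_eq_square flip: abs_square_le_1)
      qed
      then have "f' x \<in> {-1..1}" if "x \<in> W" for x using that by (simp add: abs_le_iff)
      moreover have "f' x = 0" if "x \<notin> W" for x using that by (simp add: f'_def)
      ultimately show ?thesis by (simp add: Box_def PiE_UNIV_domain Pi_iff)
    qed
    moreover have "f' \<in> U" using f(1) by (simp add: U_def 1)
    ultimately have "f' \<in> K" using 2 by (simp add: K_def)
    then show ?thesis using r(1) by (intro bexI[of _ f'] exI[of _ r]) (auto simp: f'_def)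
  qed
  have "K \<noteq> {}"
  proof -
    obtain c where c: "\<exists>x\<in>W. c x \<noteq> 0" "\<forall>i\<in>{..<k}. (\<Sum>x\<in>W. e i x * c x) = 0"
      using homogeneous_system_nontrivial_solution[of "{..<k}" W e] fin k by auto
    have "c \<in> U" using c(2) by (simp add: U_def inner_on_def)
    moreover have "inner_on W c c \<noteq> 0" using c(1) by (simp add: inner_on_self_eq_0[OF fin])
    ultimately show ?thesis using normalize[of c] by auto
  qed
  moreover have "continuous_on K Q"
    unfolding Q_def
    by (rule continuous_on_subset[OF cont]) (auto simp: kernel_op_def intro!: continuous_intros)
  ultimately obtain f where f: "f \<in> K" and max: "\<And>g. g \<in> K \<Longrightarrow> Q g \<le> Q f"
    using continuous_attains_sup[OF cK] by blast
  define \<mu> where "\<mu> = Q f"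
  have ff: "inner_on W f f = 1" and fU: "f \<in> U" using f by (auto simp: K_def)
  have Qle: "Q g \<le> \<mu> * inner_on W g g" if g: "g \<in> U" for g
  proof (cases "inner_on W g g = 0")
    case True
    then have "\<forall>x\<in>W. g x = 0" using fin by (simp add: inner_on_self_eq_0)
    then show ?thesis using True by (simp add: Q_def inner_on_def)
  next
    case False
    obtain g' r where g': "g' \<in> K" "r > 0" "\<And>x. x \<in> W \<Longrightarrow> g x = r * g' x"
      using normalize[OF g False] by blast
    have "Q g = inner_on W (kernel_op W A (\<lambda>x. r * g' x)) (\<lambda>x. r * g' x)"
      unfolding Q_def using g'(3) by (intro inner_on_cong kernel_op_cong) auto
    also have "\<dots> = r * r * Q g'"
      unfolding kernel_op_scale inner_on_scale_right inner_on_scale_left Q_def by simp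
    also have "\<dots> \<le> r * r * \<mu>"
      using max[OF g'(1)] g'(2) by (simp add: \<mu>_def)
    also have "r * r = inner_on W (\<lambda>x. r * g' x) (\<lambda>x. r * g' x)"
      unfolding inner_on_scale_right inner_on_scale_left using g'(1) by (simp add: K_def)
    also have "\<dots> = inner_on W g g" using g'(3) by (intro inner_on_cong) auto
    finally show ?thesis by (simp add: mult.commute)
  qed
  \<comment> \<open>The defect \<open>h\<close> lies in \<open>U\<close>, hence is an admissible direction of variation at \<open>f\<close>.\<close>
  define h where "h x = kernel_op W A f x - \<mu> * f x" for x
  have hU: "h \<in> U"
  proof -
    have "inner_on W (e i) (kernel_op W A f) = 0" if "i < k" for i
    proof -
      have "inner_on W (e i) (kernel_op W A f) = inner_on W (kernel_op W A (e i)) f"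
        by (simp add: self_adjoint_inner_on[OF sa])
      also have "\<dots> = inner_on W (\<lambda>x. l i * e i x) f"
        by (rule inner_on_cong) (auto simp: eig that)
      also have "\<dots> = 0" using fU that by (simp add: inner_on_scale_left U_def)
      finally show ?thesis .
    qed
    then show ?thesis using fU
      by (simp add: U_def h_def[abs_def] inner_on_diff_right inner_on_scale_right)
  qed
  have "\<tau> * (2 * inner_on W h h) \<le> \<tau>\<^sup>2 * (\<mu> * inner_on W h h - Q h)" for \<tau>
  proof -
    define g where "g = (\<lambda>x. f x + \<tau> * h x)"
    have "g \<in> U" using fU hU by (simp add: U_def g_def inner_on_add_right inner_on_scale_right)
    from Qle[OF this] have le: "Q g \<le> \<mu> * inner_on W g g" .
    have "kernel_op W A g = (\<lambda>x. kernel_op W A f x + \<tau> * kernel_op W A h x)"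
      by (simp add: g_def kernel_op_add kernel_op_scale fun_eq_iff)
    then have "Q g = Q f + \<tau> * inner_on W (kernel_op W A f) h + \<tau> * inner_on W (kernel_op W A h) f + \<tau>\<^sup>2 * Q h"
      unfolding Q_def g_def
      by (simp add: inner_on_add_right inner_on_add_left inner_on_scale_right inner_on_scale_left algebra_simps power2_eq_square)
    also have "inner_on W (kernel_op W A h) f = inner_on W (kernel_op W A f) h"
      using self_adjoint_inner_on[OF sa, of h f] by (simp only: inner_on_commute[of W h])
    finally have Qg: "Q g = \<mu> + 2 * \<tau> * inner_on W (kernel_op W A f) h + \<tau>\<^sup>2 * Q h" by (simp add: \<mu>_def)
    have gg: "inner_on W g g = 1 + 2 * \<tau> * inner_on W f h + \<tau>\<^sup>2 * inner_on W h h"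
      unfolding g_def using inner_on_commute[of W h f]
      by (simp add: inner_on_add_right inner_on_add_left inner_on_scale_right inner_on_scale_left ff algebra_simps power2_eq_square)
    have "inner_on W h h = inner_on W h (\<lambda>x. kernel_op W A f x - \<mu> * f x)" by (simp add: h_def[abs_def])
    then have "inner_on W h h = inner_on W (kernel_op W A f) h - \<mu> * inner_on W f h"
      unfolding inner_on_diff_right inner_on_scale_right
      using inner_on_commute[of W h f] inner_on_commute[of W h "kernel_op W A f"] by simp
    then have "inner_on W (kernel_op W A f) h = inner_on W h h + \<mu> * inner_on W f h" by simp
    with le Qg gg show ?thesis by (simp add: algebra_simps)
  qed
  from linear_le_quadratic_imp_zero[OF this] have "inner_on W h h = 0" by simp
  then have "\<forall>x\<in>W. kernel_op W A f x = \<mu> * f x" using fin by (simp add: inner_on_self_eq_0 h_def)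
  then show ?thesis using ff fU by (auto simp: U_def)
qed

lemma spectral_theorem_kernel:
  assumes fin: "finite W" and sa: "self_adjoint_on W A"
  obtains e and l :: "nat \<Rightarrow> real" where "eigensystem W A {..<card W} e l"
proof -
  have "\<exists>(e :: nat \<Rightarrow> _) l. (\<forall>i<k. \<forall>j<k. inner_on W (e i) (e j) = (if i = j then 1 else 0)) \<and>
    (\<forall>i<k. \<forall>x\<in>W. kernel_op W A (e i) x = l i * e i x)" if "k \<le> card W" for k
    using that
  proof (induction k)
    case 0
    then show ?case by simp
  next
    case (Suc k)
    have "k < card W" using Suc.prems by simp
    then have "k \<le> card W" by simp
    from Suc.IH[OF this] obtain e l where
      e: "\<forall>i<k. \<forall>j<k. inner_on W (e i) (e j) = (if i = j then 1 else 0)"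
      and l': "\<forall>i<k. \<forall>x\<in>W. kernel_op W A (e i) x = l i * e i x" by blast
    have l: "kernel_op W A (e i) x = l i * e i x" if "i < k" "x \<in> W" for i x
      using l' that by blast
    from extend_eigenfunctions[OF fin sa \<open>k < card W\<close>, of e l, OF l] obtain f \<mu> where
      f: "inner_on W f f = 1" "\<And>i. i < k \<Longrightarrow> inner_on W (e i) f = 0"
        "\<And>x. x \<in> W \<Longrightarrow> kernel_op W A f x = \<mu> * f x" by blast
    have "inner_on W f (e i) = 0" if "i < k" for i using f(2)[OF that] by (simp add: inner_on_commute)
    then show ?case using e l f
      by (intro exI[of _ "e(k := f)"] exI[of _ "l(k := \<mu>)"]) (auto simp: less_Suc_eq)
  qed
  from this[OF order_refl] obtain e and l :: "nat \<Rightarrow> real" where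
    "\<forall>i<card W. \<forall>j<card W. inner_on W (e i) (e j) = (if i = j then 1 else 0)"
    "\<forall>i<card W. \<forall>x\<in>W. kernel_op W A (e i) x = l i * e i x" by blast
  then have "eigensystem W A {..<card W} e l" by (simp add: eigensystem_def)
  then show thesis by (rule that)
qed

text \<open>An orthonormal family of full cardinality is complete.\<close>

lemma eigensystem_orthogonal_imp_zero:
  assumes fin: "finite W" and es: "eigensystem W A I e l"
    and orth: "\<And>i. i \<in> I \<Longrightarrow> inner_on W (e i) f = 0" and x: "x \<in> W"
  shows "f x = 0"
proof (rule ccontr)
  assume "f x \<noteq> 0"
  then have ff: "inner_on W f f \<noteq> 0" using fin x by (auto simp: inner_on_self_eq_0)
  have I: "finite I" "card I = card W" using es by (auto simp: eigensystem_def)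
  \<comment> \<open>Together with \<open>f\<close> the family has more members than \<open>W\<close> has points, hence is dependent.\<close>
  define g where "g = case_option f e"
  have orth': "inner_on W f (e i) = 0" if "i \<in> I" for i
    using orth[OF that] by (simp add: inner_on_commute[of W f "e i"])
  have orthg: "inner_on W (g a) (g b) = 0" if "a \<in> insert None (Some ` I)" "b \<in> insert None (Some ` I)" "a \<noteq> b" for a b
  proof -
    note ab = that
    show ?thesis
    proof (cases "a = None \<or> b = None")
      case True
      then show ?thesis using ab orth orth' by (auto simp: g_def)
    next
      case False
      then obtain i j where ij: "i \<in> I" "a = Some i" "j \<in> I" "b = Some j" using ab by blast
      then have "inner_on W (e i) (e j) = 0" using es ab(3) by (auto simp: eigensystem_def)
      then show ?thesis using ij by (simp add: g_def)
    qed
  qed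
  have nz: "inner_on W (g a) (g a) \<noteq> 0" if "a \<in> insert None (Some ` I)" for a
    using that es ff by (auto simp: g_def eigensystem_def)
  have "card W < card (insert None (Some ` I))"
    using I by (simp add: card_image)
  from homogeneous_system_nontrivial_solution[OF fin _ this, of "\<lambda>x a. g a x"] I obtain c where
    c: "\<exists>a\<in>insert None (Some ` I). c a \<noteq> 0"
    "\<And>y. y \<in> W \<Longrightarrow> (\<Sum>a\<in>insert None (Some ` I). c a * g a y) = 0"
    by (auto simp: mult.commute)
  then obtain b where b: "b \<in> insert None (Some ` I)" "c b \<noteq> 0" by blast
  have "0 = inner_on W (g b) (\<lambda>y. \<Sum>a\<in>insert None (Some ` I). c a * g a y)"
    using c(2) by (simp add: inner_on_def)
  also have "\<dots> = (\<Sum>a\<in>insert None (Some ` I). c a * inner_on W (g b) (g a))"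
    by (rule inner_on_sum_right)
  also have "\<dots> = (\<Sum>a\<in>insert None (Some ` I). if a = b then c a * inner_on W (g b) (g b) else 0)"
    using b orthg by (intro sum.cong) auto
  also have "\<dots> = c b * inner_on W (g b) (g b)" using b I by (subst sum.delta) auto
  finally show False using b nz by simp
qed

lemma eigensystem_expansion:
  assumes fin: "finite W" and es: "eigensystem W A I e l" and x: "x \<in> W"
  shows "f x = (\<Sum>i\<in>I. inner_on W (e i) f * e i x)"
proof -
  have I: "finite I" using es by (simp add: eigensystem_def)
  define h where "h y = f y - (\<Sum>i\<in>I. inner_on W (e i) f * e i y)" for y
  have "inner_on W (e j) h = 0" if j: "j \<in> I" for j
  proof -
    have "inner_on W (e j) h = inner_on W (e j) f - (\<Sum>i\<in>I. inner_on W (e i) f * inner_on W (e j) (e i))"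
      by (simp add: h_def[abs_def] inner_on_diff_right inner_on_sum_right)
    also have "(\<Sum>i\<in>I. inner_on W (e i) f * inner_on W (e j) (e i)) = (\<Sum>i\<in>I. if i = j then inner_on W (e i) f else 0)"
      using es j by (intro sum.cong) (auto simp: eigensystem_def)
    finally show ?thesis using I j by simp
  qed
  from eigensystem_orthogonal_imp_zero[OF fin es this x] show ?thesis by (simp add: h_def)
qed

lemma quadratic_form_span_eigenfunctions:
  assumes es: "eigensystem W A I e l" and J: "J \<subseteq> I"
    and f: "\<And>x. x \<in> W \<Longrightarrow> f x = (\<Sum>i\<in>J. c i * e i x)"
  shows "inner_on W (kernel_op W A f) f = (\<Sum>i\<in>J. l i * (c i)\<^sup>2)" (is ?A)
    and "inner_on W f f = (\<Sum>i\<in>J. (c i)\<^sup>2)" (is ?B)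
proof -
  let ?f = "\<lambda>x. \<Sum>i\<in>J. c i * e i x"
  have finJ: "finite J" using es J finite_subset by (auto simp: eigensystem_def)
  have ef: "inner_on W ?f (e j) = c j" if j: "j \<in> J" for j
  proof -
    have "inner_on W ?f (e j) = (\<Sum>i\<in>J. c i * inner_on W (e j) (e i))"
      using inner_on_commute[of W ?f "e j"] by (simp add: inner_on_sum_right)
    also have "\<dots> = (\<Sum>i\<in>J. if i = j then c i else 0)"
      using es j J by (intro sum.cong) (auto simp: eigensystem_def subset_iff)
    finally show ?thesis using finJ j by simp
  qed
  have ff: "inner_on W f g = inner_on W ?f g" for g by (intro inner_on_cong f) auto
  have "inner_on W f f = inner_on W ?f f" by (rule ff)
  also have "\<dots> = inner_on W ?f ?f" by (intro inner_on_cong f) auto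
  also have "\<dots> = (\<Sum>i\<in>J. c i * inner_on W ?f (e i))" by (rule inner_on_sum_right)
  finally show ?B using ef by (simp add: power2_eq_square)
  have "inner_on W (kernel_op W A f) f = inner_on W f (kernel_op W A f)" by (rule inner_on_commute)
  also have "\<dots> = inner_on W ?f (\<lambda>x. \<Sum>i\<in>J. (c i * l i) * e i x)"
    unfolding ff
  proof (rule inner_on_cong)
    fix x assume x: "x \<in> W"
    have "kernel_op W A f x = kernel_op W A ?f x" by (intro kernel_op_cong f)
    also have "\<dots> = (\<Sum>i\<in>J. c i * kernel_op W A (e i) x)" by (rule kernel_op_sum)
    also have "\<dots> = (\<Sum>i\<in>J. (c i * l i) * e i x)"
      using es J x by (intro sum.cong) (auto simp: eigensystem_def)
    finally show "kernel_op W A f x = (\<Sum>i\<in>J. (c i * l i) * e i x)" .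
  qed simp
  also have "\<dots> = (\<Sum>i\<in>J. (c i * l i) * inner_on W ?f (e i))" by (rule inner_on_sum_right)
  finally show ?A using ef by (simp add: power2_eq_square mult_ac)
qed

text \<open>
  A Courant--Fischer argument. If the left-hand side were larger, some nonzero combination of
  eigenfunctions of \<open>A\<close> for eigenvalues at most \<open>t\<close> would vanish on \<open>R\<close> and be orthogonal to the
  eigenfunctions of \<open>A'\<close> for eigenvalues at most \<open>t\<close>. The two quadratic forms agree on it, as its
  support avoids \<open>R\<close>, but one of them is at most and the other larger than \<open>t\<close> times its squared norm.
\<close>

lemma eigenvalue_count_le:
  assumes fin: "finite W" and es: "eigensystem W A I e l" and es': "eigensystem W A' I' e' l'"
    and R: "R \<subseteq> W" and agree: "\<And>x y. x \<in> W - R \<Longrightarrow> y \<in> W \<Longrightarrow> A x y = A' x y"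
  shows "card {i\<in>I. l i \<le> t} \<le> card {i\<in>I'. l' i \<le> t} + card R"
proof (rule ccontr)
  assume contr: "\<not> ?thesis"
  define J where "J = {i\<in>I. l i \<le> t}"
  define J' where "J' = {i\<in>I'. l' i \<le> t}"
  have finI: "finite I" "finite I'" using es es' by (auto simp: eigensystem_def)
  then have finJ: "finite J" "finite J'" by (auto simp: J_def J'_def)
  have finR: "finite R" using R fin by (rule finite_subset)
  \<comment> \<open>The equations: \<open>f\<close> vanishes on \<open>R\<close> and is orthogonal to the low eigenfunctions of \<open>A'\<close>.\<close>
  define M where "M = case_sum (\<lambda>x i. e i x) (\<lambda>j i. inner_on W (e' j) (e i))"
  have "card (R <+> J') < card J"
    using contr finJ finR by (simp add: card_Plus J_def J'_def)
  then have "\<exists>c. (\<exists>i\<in>J. c i \<noteq> 0) \<and> (\<forall>a\<in>R <+> J'. (\<Sum>i\<in>J. M a i * c i) = 0)"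
    using finR finJ by (intro homogeneous_system_nontrivial_solution) auto
  then obtain c where c: "\<exists>i\<in>J. c i \<noteq> 0" "\<And>a. a \<in> R <+> J' \<Longrightarrow> (\<Sum>i\<in>J. M a i * c i) = 0"
    by metis
  define f where "f x = (\<Sum>i\<in>J. c i * e i x)" for x
  have fR: "f x = 0" if "x \<in> R" for x
    using c(2)[OF InlI[OF that]] by (simp add: M_def f_def mult.commute)
  have orth: "inner_on W (e' j) f = 0" if "j \<in> J'" for j
    using c(2)[OF InrI[OF that]] by (simp add: M_def f_def[abs_def] inner_on_sum_right mult.commute)
  have Jsub: "J \<subseteq> I" by (auto simp: J_def)
  note qA = quadratic_form_span_eigenfunctions[OF es Jsub f_def]
  have exp': "f x = (\<Sum>i\<in>I'. inner_on W (e' i) f * e' i x)" if "x \<in> W" for x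
    by (rule eigensystem_expansion[OF fin es' that])
  have qA': "inner_on W (kernel_op W A' f) f = (\<Sum>i\<in>I'. l' i * (inner_on W (e' i) f)\<^sup>2)"
    "inner_on W f f = (\<Sum>i\<in>I'. (inner_on W (e' i) f)\<^sup>2)"
    using quadratic_form_span_eigenfunctions[where f = f and c = "\<lambda>i. inner_on W (e' i) f", OF es' order_refl exp']
    by auto
  have "(\<Sum>i\<in>J. (c i)\<^sup>2) \<noteq> 0"
    using c(1) finJ by (simp add: sum_nonneg_eq_0_iff)
  then have pos: "inner_on W f f > 0"
    using qA(2) inner_on_self_nonneg[of W f] by linarith
  have le: "inner_on W (kernel_op W A f) f \<le> t * inner_on W f f"
    unfolding qA sum_distrib_left
    by (intro sum_mono mult_right_mono) (auto simp: J_def)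
  have "\<exists>i\<in>I'. inner_on W (e' i) f \<noteq> 0"
  proof (rule ccontr)
    assume "\<not> ?thesis"
    then have "inner_on W f f = 0" using qA'(2) by simp
    then show False using pos by simp
  qed
  then obtain k where k: "k \<in> I'" "inner_on W (e' k) f \<noteq> 0" by blast
  have "(\<Sum>i\<in>I'. t * (inner_on W (e' i) f)\<^sup>2) < (\<Sum>i\<in>I'. l' i * (inner_on W (e' i) f)\<^sup>2)"
  proof (rule sum_strict_mono_ex1[OF finI(2)])
    show "\<forall>i\<in>I'. t * (inner_on W (e' i) f)\<^sup>2 \<le> l' i * (inner_on W (e' i) f)\<^sup>2"
    proof
      fix i assume "i \<in> I'"
      then show "t * (inner_on W (e' i) f)\<^sup>2 \<le> l' i * (inner_on W (e' i) f)\<^sup>2"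
        using orth[of i] by (cases "i \<in> J'") (auto simp: J'_def intro!: mult_right_mono)
    qed
    have "k \<notin> J'" using k orth by blast
    then have "t < l' k" using k by (simp add: J'_def)
    then show "\<exists>i\<in>I'. t * (inner_on W (e' i) f)\<^sup>2 < l' i * (inner_on W (e' i) f)\<^sup>2"
      using k by (intro bexI[of _ k]) auto
  qed
  then have gt: "t * inner_on W f f < inner_on W (kernel_op W A' f) f"
    unfolding qA' sum_distrib_left .
  have "inner_on W (kernel_op W A f) f = inner_on W (kernel_op W A' f) f"
    unfolding inner_on_def
  proof (rule sum.cong[OF refl])
    fix x assume x: "x \<in> W"
    show "kernel_op W A f x * f x = kernel_op W A' f x * f x"
    proof (cases "x \<in> R")
      case False
      then have "kernel_op W A f x = kernel_op W A' f x"
        unfolding kernel_op_def using x agree by (intro sum.cong) auto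
      then show ?thesis by simp
    qed (simp add: fR)
  qed
  then show False using le gt by simp
qed

section \<open>Counting eigenvalues through the characteristic polynomial\<close>

lemma order_prod_linear_factors:
  fixes l :: "'i \<Rightarrow> real"
  assumes "finite I"
  shows "order \<mu> (\<Prod>i\<in>I. [:- l i, 1:]) = card {i\<in>I. l i = \<mu>}"
  using assms
proof (induction I rule: finite_induct)
  case empty
  then show ?case by (simp add: order_0I)
next
  case (insert k I)
  have ord: "order \<mu> [:- l k, 1:] = (if l k = \<mu> then 1 else 0)"
    using order_power_n_n[of "l k" 1] by (auto intro: order_0I)
  have "(\<Prod>i\<in>insert k I. [:- l i, 1:]) \<noteq> 0"
    using insert.hyps(1) by (subst prod_zero_iff) auto
  then have "order \<mu> (\<Prod>i\<in>insert k I. [:- l i, 1:]) =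
      order \<mu> [:- l k, 1:] + order \<mu> (\<Prod>i\<in>I. [:- l i, 1:])"
    unfolding prod.insert[OF insert.hyps] by (rule order_mult)
  also have "\<dots> = (if l k = \<mu> then 1 else 0) + card {i\<in>I. l i = \<mu>}"
    by (simp add: ord insert)
  also have "\<dots> = card {i\<in>insert k I. l i = \<mu>}"
  proof (cases "l k = \<mu>")
    case True
    then have "{i\<in>insert k I. l i = \<mu>} = insert k {i\<in>I. l i = \<mu>}" by auto
    then show ?thesis using True insert by simp
  next
    case False
    then have "{i\<in>insert k I. l i = \<mu>} = {i\<in>I. l i = \<mu>}" by auto
    then show ?thesis using False by simp
  qed
  finally show ?case .
qed

lemma char_poly_kernel_mat:
  assumes fin: "finite W" and es: "eigensystem W A {..<card W} e l"
  shows "char_poly (kernel_mat W A) = (\<Prod>i<card W. [:- l i, 1:])"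
proof -
  define n where "n = card W"
  define xs where "xs = (SOME xs. distinct xs \<and> set xs = W)"
  have xs: "distinct xs" "set xs = W"
    using someI_ex[of "\<lambda>xs. distinct xs \<and> set xs = W"] finite_distinct_list[OF fin]
    unfolding xs_def by auto
  have len: "length xs = n" using xs distinct_card n_def by metis
  have nth: "xs ! i \<in> W" if "i < n" for i using that len xs(2) nth_mem by metis
  have reindex: "(\<Sum>i<n. f (xs ! i)) = sum f W" for f :: "_ \<Rightarrow> real"
    by (rule sum.reindex_bij_betw[OF bij_betw_nth]) (use xs len in auto)
  define M where "M = mat n n (\<lambda>(i, j). A (xs ! i) (xs ! j))"
  define P where "P = mat n n (\<lambda>(i, j). e j (xs ! i))"
  define D where "D = mat n n (\<lambda>(i, j). if i = j then l i else 0)"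
  have M: "kernel_mat W A = M" by (simp add: kernel_mat_def M_def n_def xs_def Let_def)
  have carr: "M \<in> carrier_mat n n" "P \<in> carrier_mat n n" "D \<in> carrier_mat n n"
    "transpose_mat P \<in> carrier_mat n n"
    by (auto simp: M_def P_def D_def)
  have PP: "transpose_mat P * P = 1\<^sub>m n"
  proof (rule eq_matI)
    fix i j assume "i < dim_row (1\<^sub>m n :: real mat)" "j < dim_col (1\<^sub>m n :: real mat)"
    then have ij: "i < n" "j < n" by auto
    have "(transpose_mat P * P) $$ (i, j) = (\<Sum>k<n. e i (xs ! k) * e j (xs ! k))"
      using ij by (simp add: P_def scalar_prod_def atLeast0LessThan)
    also have "\<dots> = inner_on W (e i) (e j)" using reindex[of "\<lambda>x. e i x * e j x"] by (simp add: inner_on_def)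
    finally show "(transpose_mat P * P) $$ (i, j) = 1\<^sub>m n $$ (i, j)"
      using es ij by (simp add: eigensystem_def n_def)
  qed (auto simp: P_def)
  have PP': "P * transpose_mat P = 1\<^sub>m n"
    using mat_mult_left_right_inverse[OF carr(4) carr(2) PP] .
  have MP: "M * P = P * D"
  proof (rule eq_matI)
    fix i j assume "i < dim_row (P * D)" "j < dim_col (P * D)"
    then have ij: "i < n" "j < n" by (auto simp: P_def D_def)
    have "(M * P) $$ (i, j) = (\<Sum>k<n. A (xs ! i) (xs ! k) * e j (xs ! k))"
      using ij by (simp add: M_def P_def scalar_prod_def atLeast0LessThan)
    also have "\<dots> = kernel_op W A (e j) (xs ! i)" using reindex[of "\<lambda>x. A (xs ! i) x * e j x"] by (simp add: kernel_op_def)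
    also have "\<dots> = l j * e j (xs ! i)" using es ij nth by (simp add: eigensystem_def n_def)
    also have "\<dots> = (\<Sum>k<n. e k (xs ! i) * (if k = j then l k else 0))"
      using ij by (simp add: if_distrib[of "\<lambda>x. _ * x"] cong: if_cong)
    also have "\<dots> = (P * D) $$ (i, j)"
      using ij by (simp add: D_def P_def scalar_prod_def atLeast0LessThan)
    finally show "(M * P) $$ (i, j) = (P * D) $$ (i, j)" .
  qed (auto simp: M_def P_def D_def)
  have "M = M * (P * transpose_mat P)" using carr by (simp add: PP')
  also have "\<dots> = P * D * transpose_mat P"
    using carr by (simp add: MP flip: assoc_mult_mat)
  finally have "similar_mat M D"
    using carr PP PP' by (intro similar_matI[of _ _ P "transpose_mat P" n]) auto
  then have "char_poly M = char_poly D" by (rule char_poly_similar)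
  also have "\<dots> = (\<Prod>a \<leftarrow> diag_mat D. [:- a, 1:])"
    by (rule char_poly_upper_triangular[OF carr(3)]) (auto simp: D_def)
  also have "diag_mat D = map l [0..<n]"
    by (auto simp: diag_mat_def D_def intro: nth_equalityI)
  also have "(\<Prod>a \<leftarrow> map l [0..<n]. [:- a, 1:]) = (\<Prod>i<n. [:- l i, 1:])"
    by (simp add: prod.distinct_set_conv_list[symmetric] atLeast0LessThan comp_def)
  finally show ?thesis by (simp add: M n_def)
qed

lemma spectral_distribution_eigensystem:
  assumes fin: "finite W" and es: "eigensystem W A {..<card W} e l"
  shows "spectral_distribution W A t = real (card {i\<in>{..<card W}. l i \<le> t}) / real (card W)"
proof -
  let ?I = "{..<card W}"
  note cp = char_poly_kernel_mat[OF fin es]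
  have "kernel_mat W A \<in> carrier_mat (card W) (card W)"
    by (simp add: kernel_mat_def Let_def)
  from eigenvalue_root_char_poly[OF this]
  have ev: "eigenvalue (kernel_mat W A) \<mu> \<longleftrightarrow> \<mu> \<in> l ` ?I" for \<mu>
    by (auto simp: cp poly_prod)
  have "(\<Sum>\<mu> | eigenvalue (kernel_mat W A) \<mu> \<and> \<mu> \<le> t. order \<mu> (char_poly (kernel_mat W A))) =
      (\<Sum>\<mu>\<in>l ` {i\<in>?I. l i \<le> t}. card {i\<in>?I. l i = \<mu>})"
    by (intro sum.cong) (auto simp: ev cp order_prod_linear_factors)
  also have "\<dots> = (\<Sum>\<mu>\<in>l ` {i\<in>?I. l i \<le> t}. \<Sum>i\<in>{i\<in>{i\<in>?I. l i \<le> t}. l i = \<mu>}. 1)"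
    by (intro sum.cong refl) (auto intro!: arg_cong[of _ _ card])
  also have "\<dots> = (\<Sum>i\<in>{i\<in>?I. l i \<le> t}. 1)"
    by (rule sum.group) auto
  finally show ?thesis by (simp add: spectral_distribution_def)
qed

section \<open>Disjoint copies of a kernel\<close>

text \<open>
  The kernel of \<open>q\<close> disjoint copies of a kernel on \<open>U\<close>, transported to a set \<open>W\<close> along a bijection
  \<open>\<rho>\<close> from \<open>W\<close> to \<open>U \<times> {..<q}\<close>.
\<close>

definition copied_kernel :: "('w \<Rightarrow> 'v \<times> nat) \<Rightarrow> ('v \<Rightarrow> 'v \<Rightarrow> real) \<Rightarrow> 'w \<Rightarrow> 'w \<Rightarrow> real" where
  "copied_kernel \<rho> A w w' = (if snd (\<rho> w) = snd (\<rho> w') then A (fst (\<rho> w)) (fst (\<rho> w')) else 0)"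

lemma eigensystem_copied_kernel:
  assumes fin: "finite U" and \<rho>: "bij_betw \<rho> W (U \<times> {..<q})" and es: "eigensystem U A I e l"
  shows "eigensystem W (copied_kernel \<rho> A) (I \<times> {..<q})
    (\<lambda>(i, j) w. if snd (\<rho> w) = j then e i (fst (\<rho> w)) else 0) (\<lambda>(i, j). l i)"
proof -
  have sum: "(\<Sum>w\<in>W. F (fst (\<rho> w)) (snd (\<rho> w))) = (\<Sum>x\<in>U. \<Sum>j<q. F x j)" for F :: "_ \<Rightarrow> _ \<Rightarrow> real"
    using sum.reindex_bij_betw[OF \<rho>, of "\<lambda>(x, j). F x j"]
    by (simp add: sum.cartesian_product case_prod_unfold)
  have mem: "fst (\<rho> w) \<in> U" "snd (\<rho> w) < q" if "w \<in> W" for w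
    using bij_betw_apply[OF \<rho> that] by auto
  have "card (I \<times> {..<q}) = card W"
    using es bij_betw_same_card[OF \<rho>] by (simp add: eigensystem_def card_cartesian_product)
  moreover have "inner_on W (\<lambda>w. if snd (\<rho> w) = j then e i (fst (\<rho> w)) else 0)
      (\<lambda>w. if snd (\<rho> w) = j' then e i' (fst (\<rho> w)) else 0) = (if (i, j) = (i', j') then 1 else 0)"
    if "i \<in> I" "i' \<in> I" "j < q" for i i' j j'
  proof -
    have "inner_on W (\<lambda>w. if snd (\<rho> w) = j then e i (fst (\<rho> w)) else 0)
      (\<lambda>w. if snd (\<rho> w) = j' then e i' (fst (\<rho> w)) else 0) =
      (\<Sum>x\<in>U. \<Sum>k<q. if k = j then (if j = j' then e i x * e i' x else 0) else 0)"
      unfolding inner_on_def sum[symmetric] by (intro sum.cong) auto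
    also have "\<dots> = (if j = j' then inner_on U (e i) (e i') else 0)"
      using that by (simp add: inner_on_def)
    finally show ?thesis using es that by (simp add: eigensystem_def)
  qed
  moreover have "kernel_op W (copied_kernel \<rho> A) (\<lambda>w. if snd (\<rho> w) = j then e i (fst (\<rho> w)) else 0) w
      = l i * (if snd (\<rho> w) = j then e i (fst (\<rho> w)) else 0)" if "i \<in> I" "j < q" "w \<in> W" for i j w
  proof -
    have "kernel_op W (copied_kernel \<rho> A) (\<lambda>w. if snd (\<rho> w) = j then e i (fst (\<rho> w)) else 0) w =
      (\<Sum>x\<in>U. \<Sum>k<q. if k = j then (if snd (\<rho> w) = j then A (fst (\<rho> w)) x * e i x else 0) else 0)"
      unfolding kernel_op_def copied_kernel_def
      unfolding sum[symmetric] by (intro sum.cong) auto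
    also have "\<dots> = (if snd (\<rho> w) = j then kernel_op U A (e i) (fst (\<rho> w)) else 0)"
      using that by (simp add: kernel_op_def)
    finally show ?thesis using es that mem by (simp add: eigensystem_def)
  qed
  moreover have "finite (I \<times> {..<q})" using es by (simp add: eigensystem_def)
  ultimately show ?thesis by (auto simp: eigensystem_def)
qed

text \<open>
  Passing to disjoint copies does not change normalised eigenvalue counts, so kernels on sets of
  different sizes can be compared on a common set \<open>W\<close>.
\<close>

lemma spectral_distribution_le:
  assumes fin: "finite U" "finite U'"
    and sa: "self_adjoint_on U A" "self_adjoint_on U' A'"
    and \<rho>: "bij_betw \<rho> W (U \<times> {..<q})" and \<rho>': "bij_betw \<rho>' W (U' \<times> {..<q'})"
    and ne: "W \<noteq> {}" and R: "R \<subseteq> W"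
    and agree: "\<And>x y. x \<in> W - R \<Longrightarrow> y \<in> W \<Longrightarrow> copied_kernel \<rho> A x y = copied_kernel \<rho>' A' x y"
  shows "spectral_distribution U A t \<le> spectral_distribution U' A' t + real (card R) / real (card W)"
proof -
  obtain e l where es: "eigensystem U A {..<card U} e l"
    using spectral_theorem_kernel[OF fin(1) sa(1)] .
  obtain e' l' where es': "eigensystem U' A' {..<card U'} e' l'"
    using spectral_theorem_kernel[OF fin(2) sa(2)] .
  have finW: "finite W" using bij_betw_finite[OF \<rho>] fin by simp
  have W: "card W = card U * q" "card W = card U' * q'"
    using bij_betw_same_card[OF \<rho>] bij_betw_same_card[OF \<rho>'] by (simp_all add: card_cartesian_product)
  have "card W > 0" using finW ne by (simp add: card_gt_0_iff)
  then have pos: "card W > 0" "q > 0" "q' > 0" using W by (auto intro: gr0I)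
  have count: "card {p\<in>{..<n} \<times> {..<k}. (case p of (i, j) \<Rightarrow> f i) \<le> t} = card {i\<in>{..<n}. f i \<le> t} * k"
    for n k and f :: "nat \<Rightarrow> real"
  proof -
    have "{p\<in>{..<n} \<times> {..<k}. (case p of (i, j) \<Rightarrow> f i) \<le> t} = {i\<in>{..<n}. f i \<le> t} \<times> {..<k}" by auto
    then show ?thesis by (simp add: card_cartesian_product)
  qed
  from eigenvalue_count_le[OF finW eigensystem_copied_kernel[OF fin(1) \<rho> es]
      eigensystem_copied_kernel[OF fin(2) \<rho>' es'] R agree, of t]
  have "card {i\<in>{..<card U}. l i \<le> t} * q \<le> card {i\<in>{..<card U'}. l' i \<le> t} * q' + card R"
    unfolding count .
  then have le: "real (card {i\<in>{..<card U}. l i \<le> t} * q) / card W \<le>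
      real (card {i\<in>{..<card U'}. l' i \<le> t} * q' + card R) / card W"
    by (intro divide_right_mono) (simp_all only: of_nat_le_iff of_nat_0_le_iff)
  have 1: "real (card {i\<in>{..<card U}. l i \<le> t} * q) / card W = spectral_distribution U A t"
    unfolding spectral_distribution_eigensystem[OF fin(1) es] W(1) using pos by simp
  have 2: "real (card {i\<in>{..<card U'}. l' i \<le> t} * q') / card W = spectral_distribution U' A' t"
    unfolding spectral_distribution_eigensystem[OF fin(2) es'] W(2) using pos by simp
  show ?thesis using le unfolding 1 of_nat_add add_divide_distrib 2 .
qed

section \<open>Balls in coloured graphs\<close>

text \<open>The points that can be reached from \<open>x\<close> in at most \<open>k\<close> steps of the relation \<open>R\<close>.\<close>

primrec reach :: "('v \<times> 'v) set \<Rightarrow> nat \<Rightarrow> 'v \<Rightarrow> 'v set" where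
  "reach R 0 x = {x}"
| "reach R (Suc k) x = reach R k x \<union> R `` reach R k x"

lemma self_in_reach: "x \<in> reach R k x"
  by (induction k) auto

lemma reach_subset: "R \<subseteq> U \<times> U \<Longrightarrow> x \<in> U \<Longrightarrow> reach R k x \<subseteq> U"
  by (induction k) auto

lemma reach_conv_relpow: "y \<in> reach R k x \<longleftrightarrow> (\<exists>j\<le>k. (x, y) \<in> R ^^ j)"
proof (induction k arbitrary: y)
  case (Suc k)
  have "y \<in> reach R (Suc k) x \<longleftrightarrow> (\<exists>j\<le>k. (x, y) \<in> R ^^ j) \<or> (\<exists>j\<le>k. (x, y) \<in> R ^^ Suc j)"
    using Suc.IH by (auto simp: Image_iff)
  also have "\<dots> \<longleftrightarrow> (\<exists>j\<le>Suc k. (x, y) \<in> R ^^ j)"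
    by (metis Suc_le_mono le_SucE le_SucI)
  finally show ?case .
qed auto

lemma reach_sym:
  assumes "sym R"
  shows "y \<in> reach R k x \<longleftrightarrow> x \<in> reach R k y"
proof -
  have "(y, x) \<in> R ^^ j" if "(x, y) \<in> R ^^ j" for j x y
    using that
  proof (induction j arbitrary: y)
    case (Suc j)
    then obtain z where "(x, z) \<in> R ^^ j" "(z, y) \<in> R" by auto
    then show ?case using Suc.IH assms by (meson relpow_Suc_I2 symD)
  qed auto
  then show ?thesis by (auto simp: reach_conv_relpow)
qed

lemma finite_reach: "(\<And>v. finite (R `` {v})) \<Longrightarrow> finite (reach R k x)"
proof (induction k)
  case (Suc k)
  have "R `` reach R k x = (\<Union>v\<in>reach R k x. R `` {v})" by auto
  then show ?case using Suc by auto
qed auto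

lemma card_reach_le:
  assumes "\<And>v. finite (R `` {v})" and "\<And>v. card (R `` {v}) \<le> d"
  shows "card (reach R k x) \<le> (d + 1) ^ k"
proof (induction k)
  case (Suc k)
  have fin: "finite (reach R k x)" by (rule finite_reach[OF assms(1)])
  have eq: "R `` reach R k x = (\<Union>v\<in>reach R k x. R `` {v})" by auto
  have "card (reach R (Suc k) x) \<le> card (reach R k x) + card (R `` reach R k x)"
    by (simp add: card_Un_le)
  also have "card (R `` reach R k x) \<le> (\<Sum>v\<in>reach R k x. card (R `` {v}))"
    unfolding eq by (rule card_UN_le[OF fin])
  also have "\<dots> \<le> (\<Sum>v\<in>reach R k x. d)" by (intro sum_mono assms)
  also have "card (reach R k x) + \<dots> = (d + 1) * card (reach R k x)" by simp
  also have "\<dots> \<le> (d + 1) * (d + 1) ^ k" by (intro mult_left_mono Suc) auto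
  finally show ?case by simp
qed auto

lemma reach_restrict:
  assumes "reach R k x \<subseteq> B"
  shows "reach (R \<inter> B \<times> B) k x = reach R k x"
  using assms
proof (induction k)
  case (Suc k)
  then show ?case by auto
qed auto

lemma reach_image:
  assumes "inj_on g B" "R \<subseteq> B \<times> B" "x \<in> B"
  shows "reach (map_prod g g ` R) k (g x) = g ` reach R k x"
proof (induction k)
  case (Suc k)
  have sub: "reach R k x \<subseteq> B" by (rule reach_subset[OF assms(2,3)])
  have "(map_prod g g ` R) `` (g ` reach R k x) = g ` (R `` reach R k x)"
  proof (intro equalityI subsetI)
    fix z assume "z \<in> (map_prod g g ` R) `` (g ` reach R k x)"
    then obtain u v u' where uv: "(u, v) \<in> R" "u' \<in> reach R k x" "g u' = g u" "z = g v" by auto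
    then have "u' = u" using assms sub by (auto dest: inj_onD)
    then show "z \<in> g ` (R `` reach R k x)" using uv by auto
  qed force
  then show ?case using Suc by auto
qed auto

lemma reach_cong:
  assumes "\<And>y. y \<in> reach R k x \<Longrightarrow> R `` {y} = R' `` {y}"
  shows "reach R k x = reach R' k x"
  using assms
proof (induction k)
  case (Suc k)
  have IH: "reach R k x = reach R' k x" using Suc by simp
  have "R `` reach R k x = R' `` reach R k x" using Suc.prems by auto
  then show ?case using IH by simp
qed auto

lemma awalk_iff_reach:
  assumes wf: "pair_wf_digraph D" and x: "x \<in> pverts D"
  shows "(\<exists>p. pre_digraph.awalk (with_proj D) x p y \<and> length p \<le> k) \<longleftrightarrow> y \<in> reach (parcs D) k x"
proof -
  interpret pair_wf_digraph D by fact
  show ?thesis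
  proof (induction k arbitrary: y)
    case 0
    then show ?case using x by (auto simp: awalk_Nil_iff)
  next
    case (Suc k)
    show ?case
    proof
      assume "\<exists>p. awalk x p y \<and> length p \<le> Suc k"
      then obtain p where p: "awalk x p y" "length p \<le> Suc k" by blast
      show "y \<in> reach (parcs D) (Suc k) x"
      proof (cases p rule: rev_cases)
        case Nil
        then show ?thesis using p Suc[of y] by auto
      next
        case (snoc p' e)
        then have "awalk x p' (fst e)" "e \<in> parcs D" "snd e = y"
          using p by (auto simp: awalk_append_iff awalk_Cons_iff awalk_Nil_iff)
        moreover have "length p' \<le> k" using p snoc by simp
        ultimately have "fst e \<in> reach (parcs D) k x" using Suc by blast
        then show ?thesis using \<open>e \<in> parcs D\<close> \<open>snd e = y\<close> by (cases e) auto
      qed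
    next
      assume "y \<in> reach (parcs D) (Suc k) x"
      then consider "y \<in> reach (parcs D) k x" | z where "z \<in> reach (parcs D) k x" "(z, y) \<in> parcs D"
        by auto
      then show "\<exists>p. awalk x p y \<and> length p \<le> Suc k"
      proof cases
        case 1
        then show ?thesis using Suc[of y] le_SucI by blast
      next
        case 2
        then obtain p where p: "awalk x p z" "length p \<le> k" using Suc[of z] by blast
        have "awalk x (p @ [(z, y)]) y"
          using p 2 by (auto simp: awalk_append_iff awalk_Cons_iff awalk_Nil_iff in_arcsD2)
        then show ?thesis using p by (intro exI[of _ "p @ [(z, y)]"]) auto
      qed
    qed
  qed
qed

lemma gdist_le_iff:
  assumes wf: "pair_wf_digraph (ugraph G)" and x: "x \<in> V G"
  shows "gdist G x y \<le> enat k \<longleftrightarrow> y \<in> reach (E G) k x"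
proof -
  let ?P = "{p. pre_digraph.awalk (with_proj (ugraph G)) x p y}"
  have "gdist G x y \<le> enat k \<longleftrightarrow> (\<exists>p\<in>?P. enat (length p) \<le> enat k)"
  proof
    assume le: "gdist G x y \<le> enat k"
    have "gdist G x y < enat (Suc k)" using le by (rule le_less_trans) simp
    then obtain p where "p \<in> ?P" "enat (length p) < enat (Suc k)"
      unfolding gdist_def INF_less_iff by blast
    then show "\<exists>p\<in>?P. enat (length p) \<le> enat k" by auto
  next
    assume "\<exists>p\<in>?P. enat (length p) \<le> enat k"
    then show "gdist G x y \<le> enat k" unfolding gdist_def by (auto intro: INF_lower2)
  qed
  then show ?thesis using awalk_iff_reach[OF assms, of y k] by auto
qed

lemma E_subset: "pair_wf_digraph (ugraph G) \<Longrightarrow> E G \<subseteq> V G \<times> V G"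
  by (auto dest: pair_wf_digraph.in_arcsD1 pair_wf_digraph.in_arcsD2)

lemma gball_eq:
  assumes "pair_wf_digraph (ugraph G)" and x: "x \<in> V G"
  shows "gball G k x = (G \<lparr> ugraph := \<lparr> pverts = reach (E G) k x,
    parcs = E G \<inter> reach (E G) k x \<times> reach (E G) k x \<rparr> \<rparr>, x)"
proof -
  have "{y \<in> V G. gdist G x y \<le> enat k} = reach (E G) k x"
    using reach_subset[OF E_subset[OF assms(1)] x] by (auto simp: gdist_le_iff[OF assms])
  then show ?thesis by (simp add: gball_def Let_def)
qed

section \<open>Rooted isomorphisms\<close>

lemma rooted_iso_trans:
  assumes "rooted_iso f \<alpha> \<beta>" "rooted_iso g \<beta> \<gamma>" and wf: "E (fst \<alpha>) \<subseteq> V (fst \<alpha>) \<times> V (fst \<alpha>)"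
  shows "rooted_iso (g \<circ> f) \<alpha> \<gamma>"
proof -
  have f: "bij_betw f (V (fst \<alpha>)) (V (fst \<beta>))" using assms(1) by (simp add: rooted_iso_def Let_def)
  have g: "bij_betw g (V (fst \<beta>)) (V (fst \<gamma>))" using assms(2) by (simp add: rooted_iso_def Let_def)
  have mem: "\<And>u. u \<in> V (fst \<alpha>) \<Longrightarrow> f u \<in> V (fst \<beta>)" using f by (rule bij_betw_apply)
  have "vcol (fst \<gamma>) (g (f u)) = vcol (fst \<alpha>) u" if "u \<in> V (fst \<alpha>)" for u
    using assms(1,2) mem[OF that] that by (simp add: rooted_iso_def Let_def)
  moreover have e: "(u, v) \<in> E (fst \<alpha>) \<longleftrightarrow> (f u, f v) \<in> E (fst \<beta>)"
    if "u \<in> V (fst \<alpha>)" "v \<in> V (fst \<alpha>)" for u v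
    using assms(1) that by (simp add: rooted_iso_def Let_def)
  moreover have "(f u, f v) \<in> E (fst \<beta>) \<longleftrightarrow> (g (f u), g (f v)) \<in> E (fst \<gamma>)"
    if "u \<in> V (fst \<alpha>)" "v \<in> V (fst \<alpha>)" for u v
    using assms(2) mem[OF that(1)] mem[OF that(2)] by (simp add: rooted_iso_def Let_def)
  moreover have "ecol (fst \<gamma>) (g (f u), g (f v)) = ecol (fst \<alpha>) (u, v)" if uv: "(u, v) \<in> E (fst \<alpha>)" for u v
  proof -
    have "(f u, f v) \<in> E (fst \<beta>)" using e uv wf by auto
    then have "ecol (fst \<gamma>) (g (f u), g (f v)) = ecol (fst \<beta>) (f u, f v)"
      using assms(2) by (auto simp: rooted_iso_def Let_def)
    also have "\<dots> = ecol (fst \<alpha>) (u, v)"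
      using assms(1) uv by (auto simp: rooted_iso_def Let_def)
    finally show ?thesis .
  qed
  moreover have "g (f (snd \<alpha>)) = snd \<gamma>" using assms(1,2) by (simp add: rooted_iso_def Let_def)
  ultimately show ?thesis
    using bij_betw_trans[OF f g] by (auto simp: rooted_iso_def Let_def)
qed

lemma rooted_iso_sym:
  assumes iso: "rooted_iso f \<alpha> \<beta>" and root: "snd \<alpha> \<in> V (fst \<alpha>)"
    and wf: "E (fst \<beta>) \<subseteq> V (fst \<beta>) \<times> V (fst \<beta>)"
  shows "rooted_iso (the_inv_into (V (fst \<alpha>)) f) \<beta> \<alpha>"
proof -
  let ?g = "the_inv_into (V (fst \<alpha>)) f"
  have f: "bij_betw f (V (fst \<alpha>)) (V (fst \<beta>))" and r: "f (snd \<alpha>) = snd \<beta>"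
    and e: "\<And>u v. u \<in> V (fst \<alpha>) \<Longrightarrow> v \<in> V (fst \<alpha>) \<Longrightarrow> (u, v) \<in> E (fst \<alpha>) \<longleftrightarrow> (f u, f v) \<in> E (fst \<beta>)"
    and vc: "\<And>u. u \<in> V (fst \<alpha>) \<Longrightarrow> vcol (fst \<beta>) (f u) = vcol (fst \<alpha>) u"
    and ec: "\<And>u v. (u, v) \<in> E (fst \<alpha>) \<Longrightarrow> ecol (fst \<beta>) (f u, f v) = ecol (fst \<alpha>) (u, v)"
    using iso by (auto simp: rooted_iso_def Let_def)
  have g: "bij_betw ?g (V (fst \<beta>)) (V (fst \<alpha>))" using f by (rule bij_betw_the_inv_into)
  have mem: "\<And>u. u \<in> V (fst \<beta>) \<Longrightarrow> ?g u \<in> V (fst \<alpha>)" using g by (rule bij_betw_apply)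
  have fg: "f (?g u) = u" if "u \<in> V (fst \<beta>)" for u
    using f that by (rule f_the_inv_into_f_bij_betw)
  have "?g (snd \<beta>) = snd \<alpha>"
    using the_inv_into_f_f[OF bij_betw_imp_inj_on[OF f] root] r by simp
  moreover have e': "(u, v) \<in> E (fst \<beta>) \<longleftrightarrow> (?g u, ?g v) \<in> E (fst \<alpha>)"
    if "u \<in> V (fst \<beta>)" "v \<in> V (fst \<beta>)" for u v
    using e[OF mem[OF that(1)] mem[OF that(2)]] that by (simp add: fg)
  moreover have "vcol (fst \<alpha>) (?g u) = vcol (fst \<beta>) u" if "u \<in> V (fst \<beta>)" for u
    using vc[OF mem[OF that]] that by (simp add: fg)
  moreover have "ecol (fst \<alpha>) (?g u, ?g v) = ecol (fst \<beta>) (u, v)" if uv: "(u, v) \<in> E (fst \<beta>)" for u v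
  proof -
    have "u \<in> V (fst \<beta>)" "v \<in> V (fst \<beta>)" using uv wf by auto
    then show ?thesis using ec[of "?g u" "?g v"] e' uv by (simp add: fg)
  qed
  ultimately show ?thesis using g by (auto simp: rooted_iso_def Let_def)
qed

lemma rooted_iso_image_cgraph:
  assumes inj: "inj_on g (V G)" and wf: "E G \<subseteq> V G \<times> V G"
  shows "rooted_iso g (G, x) (image_cgraph g G, g x)"
proof -
  have "(u, v) \<in> E G \<longleftrightarrow> (g u, g v) \<in> map_prod g g ` E G" if uv: "u \<in> V G" "v \<in> V G" for u v
  proof
    assume "(g u, g v) \<in> map_prod g g ` E G"
    then obtain u' v' where "(u', v') \<in> E G" "g u = g u'" "g v = g v'" by auto
    then show "(u, v) \<in> E G" using uv wf inj by (metis inj_onD mem_Sigma_iff subsetD)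
  qed force
  then show ?thesis using assms
    by (auto simp: rooted_iso_def image_cgraph_def inj_on_imp_bij_betw the_inv_into_f_f)
qed

text \<open>The ball is transported to the natural numbers along an injection of its finite vertex set.\<close>

lemma gball_has_type:
  fixes G :: "('v, 'x, 's) cgraph"
  assumes G: "xs_graph X S G" and d: "deg_le d G" and x: "x \<in> V G"
  shows "\<exists>\<alpha>\<in>ball_types d k X S. \<exists>\<phi>. rooted_iso \<phi> \<alpha> (gball G k x)"
proof -
  interpret G: pair_graph "ugraph G" using G by (simp add: xs_graph_def)
  have wf: "pair_wf_digraph (ugraph G)" by unfold_locales
  define B where "B = reach (E G) k x"
  define F where "F = E G \<inter> B \<times> B"
  define K where "K = G \<lparr> ugraph := \<lparr> pverts = B, parcs = F \<rparr> \<rparr>"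
  have ball: "gball G k x = (K, x)" by (simp add: gball_eq[OF wf x] K_def F_def B_def)
  have BV: "B \<subseteq> V G" unfolding B_def by (rule reach_subset[OF E_subset[OF wf] x])
  have finB: "finite B" using BV G.pair_finite_verts by (rule finite_subset)
  obtain g :: "'v \<Rightarrow> nat" where g: "inj_on g B" using finite_imp_inj_to_nat_seg[OF finB] by blast
  have xB: "x \<in> B" by (simp add: B_def self_in_reach)
  have FB: "F \<subseteq> B \<times> B" by (auto simp: F_def)
  have symE: "sym (E G)" using G.arcs_symmetric by (auto simp: sym_def)
  have finF: "finite F" using FB finB by (meson finite_SigmaI finite_subset)
  define H where "H = image_cgraph g K"
  have VH: "V H = g ` B" and EH: "E H = map_prod g g ` F" by (simp_all add: H_def image_cgraph_def K_def)
  have vH: "vcol H (g u) = vcol G u" if "u \<in> B" for u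
    using that g by (simp add: H_def image_cgraph_def K_def the_inv_into_f_f)
  have eH: "ecol H (g u, g v) = ecol G (u, v)" if "u \<in> B" "v \<in> B" for u v
    using that g by (simp add: H_def image_cgraph_def K_def the_inv_into_f_f)
  have symH: "sym (E H)" using symE unfolding EH F_def sym_def by force
  have wfH: "pair_wf_digraph (ugraph H)" using FB by unfold_locales (auto simp: VH EH)
  have graphH: "pair_graph (ugraph H)"
  proof -
    have "fst e \<noteq> snd e" if e: "e \<in> E H" for e
    proof -
      obtain u v where uv: "(u, v) \<in> F" "e = (g u, g v)" using e by (auto simp: EH)
      then have "u \<in> B" "v \<in> B" "u \<noteq> v" using G.no_loops' by (auto simp: F_def)
      then show ?thesis using uv g by (auto dest: inj_onD)
    qed
    moreover have "symmetric (with_proj (ugraph H))" using symH by (simp add: symmetric_def)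
    ultimately show ?thesis using FB finB finF by unfold_locales (auto simp: VH EH)
  qed
  interpret H: pair_graph "ugraph H" by (rule graphH)
  have xsH: "xs_graph X S H"
    unfolding xs_graph_def
  proof (intro conjI ballI graphH)
    fix v assume "v \<in> V H"
    then show "vcol H v \<in> X" using G BV by (auto simp: VH vH xs_graph_def)
  next
    fix e assume "e \<in> E H"
    then obtain u v where uv: "(u, v) \<in> F" "e = (g u, g v)" by (auto simp: EH)
    then show "ecol H e \<in> S" using G FB by (auto simp: eH xs_graph_def F_def)
  qed
  have rH: "reach (E H) k (g x) = V H"
  proof -
    have "reach F k x = B" unfolding F_def B_def by (rule reach_restrict) simp
    then show ?thesis using reach_image[OF g FB xB, of k] by (simp add: VH EH)
  qed
  have gx: "g x \<in> V H" using xB by (simp add: VH)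
  have distH: "gdist H (g x) y \<le> enat k" if "y \<in> V H" for y
    using that rH by (simp add: gdist_le_iff[OF wfH gx])
  have connH: "conn H"
    unfolding conn_def
  proof (rule strongly_connectedI)
    fix u v assume "u \<in> verts (with_proj (ugraph H))" "v \<in> verts (with_proj (ugraph H))"
    then have uv: "u \<in> V H" "v \<in> V H" by simp_all
    have r: "reachable (with_proj (ugraph H)) (g x) y" if "y \<in> V H" for y
      using awalk_iff_reach[OF wfH gx, of y k] that rH H.reachable_awalk by auto
    have "reachable (with_proj (ugraph H)) u (g x)" using r[OF uv(1)] by (rule H.symmetric_reachable')
    then show "reachable (with_proj (ugraph H)) u v" using r[OF uv(2)] by (rule H.reachable_trans)
  qed (use gx in auto)
  have degH: "deg_le d H"
    unfolding deg_le_def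
  proof
    fix v assume "v \<in> V H"
    then obtain u where u: "u \<in> B" "v = g u" by (auto simp: VH)
    have "out_arcs (with_proj (ugraph H)) v \<subseteq> map_prod g g ` out_arcs (with_proj (ugraph G)) u"
    proof
      fix e assume "e \<in> out_arcs (with_proj (ugraph H)) v"
      then obtain a b where ab: "(a, b) \<in> F" "e = (g a, g b)" "g a = v" by (auto simp: out_arcs_def EH)
      then have "a = u" using u FB g by (auto dest: inj_onD)
      then show "e \<in> map_prod g g ` out_arcs (with_proj (ugraph G)) u"
        using ab by (force simp: out_arcs_def F_def)
    qed
    then have "out_degree (with_proj (ugraph H)) v \<le> out_degree (with_proj (ugraph G)) u"
      unfolding out_degree_def by (rule surj_card_le[rotated]) (simp add: out_arcs_def G.pair_finite_arcs)
    also have "\<dots> \<le> d" using d u BV by (auto simp: deg_le_def)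
    finally show "out_degree (with_proj (ugraph H)) v \<le> d" .
  qed
  have "(H, g x) \<in> ball_types d k X S"
    using xsH connH degH gx distH by (simp add: ball_types_def)
  moreover have "rooted_iso g (K, x) (H, g x)"
    unfolding H_def by (rule rooted_iso_image_cgraph) (use g FB in \<open>auto simp: K_def\<close>)
  then have "rooted_iso (the_inv_into (V (fst (K, x))) g) (H, g x) (K, x)"
    by (rule rooted_iso_sym) (use xB FB in \<open>auto simp: K_def VH EH\<close>)
  ultimately show ?thesis unfolding ball by blast
qed

section \<open>Disjoint copies of a graph\<close>

text \<open>
  \<open>H\<close> is a representation on the vertex set \<open>W\<close> of \<open>q\<close> disjoint copies of \<open>G\<close>: the bijection \<open>\<rho>\<close>
  sends a vertex of \<open>H\<close> to the vertex of \<open>G\<close> below it and the number of its copy. Working with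
  \<open>\<rho>\<close> instead of its inverse makes \<open>fst \<circ> \<rho>\<close> the covering map from \<open>H\<close> to \<open>G\<close>.
\<close>

definition copied_graph ::
  "nat \<Rightarrow> ('v, 'x, 's) cgraph \<Rightarrow> ('w \<Rightarrow> 'v \<times> nat) \<Rightarrow> 'w set \<Rightarrow> ('w, 'x, 's) cgraph \<Rightarrow> bool" where
  "copied_graph q G \<rho> W H \<longleftrightarrow> bij_betw \<rho> W (V G \<times> {..<q}) \<and> V H = W \<and>
     E H = {(w, w'). w \<in> W \<and> w' \<in> W \<and> snd (\<rho> w) = snd (\<rho> w') \<and> (fst (\<rho> w), fst (\<rho> w')) \<in> E G} \<and>
     (\<forall>w\<in>W. vcol H w = vcol G (fst (\<rho> w))) \<and>
     (\<forall>w w'. (w, w') \<in> E H \<longrightarrow> ecol H (w, w') = ecol G (fst (\<rho> w), fst (\<rho> w')))"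

lemma copied_graph_copies:
  assumes wf: "E G \<subseteq> V G \<times> V G"
  shows "copied_graph q G id (V (copies q G)) (copies q G)"
  using wf by (auto simp: copied_graph_def copies_def)

lemma copied_graph_image:
  assumes cg: "copied_graph q G \<rho> W H" and f: "bij_betw f W W'"
  shows "copied_graph q G (\<rho> \<circ> the_inv_into W f) W' (image_cgraph f H)"
proof -
  let ?g = "the_inv_into W f"
  have g: "bij_betw ?g W' W" using f by (rule bij_betw_the_inv_into)
  have gf: "?g (f w) = w" if "w \<in> W" for w
    using the_inv_into_f_f[OF bij_betw_imp_inj_on[OF f] that] .
  have fg: "f (?g w) = w" if "w \<in> W'" for w
    using f that by (rule f_the_inv_into_f_bij_betw)
  have gW: "?g w \<in> W" if "w \<in> W'" for w using g that by (rule bij_betw_apply)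
  have fW: "f w \<in> W'" if "w \<in> W" for w using f that by (rule bij_betw_apply)
  have V: "V H = W" and EW: "E H \<subseteq> W \<times> W" using cg by (auto simp: copied_graph_def)
  have E: "E (image_cgraph f H) = {(w, w'). w \<in> W' \<and> w' \<in> W' \<and> (?g w, ?g w') \<in> E H}"
  proof (intro equalityI subsetI)
    fix p assume "p \<in> E (image_cgraph f H)"
    then obtain a b where ab: "(a, b) \<in> E H" "p = (f a, f b)" by (auto simp: image_cgraph_def)
    then have "a \<in> W" "b \<in> W" using EW by auto
    then show "p \<in> {(w, w'). w \<in> W' \<and> w' \<in> W' \<and> (?g w, ?g w') \<in> E H}"
      using ab by (simp add: gf fW)
  next
    fix p assume "p \<in> {(w, w'). w \<in> W' \<and> w' \<in> W' \<and> (?g w, ?g w') \<in> E H}"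
    then obtain w w' where p: "p = (w, w')" "w \<in> W'" "w' \<in> W'" "(?g w, ?g w') \<in> E H" by auto
    then have "p = map_prod f f (?g w, ?g w')" by (simp add: fg)
    then show "p \<in> E (image_cgraph f H)" using p(4) by (auto simp: image_cgraph_def)
  qed
  have "bij_betw \<rho> W (V G \<times> {..<q})" using cg by (simp add: copied_graph_def)
  then have "bij_betw (\<rho> \<circ> ?g) W' (V G \<times> {..<q})" by (rule bij_betw_trans[OF g])
  moreover have "V (image_cgraph f H) = W'"
    using f by (simp add: image_cgraph_def V bij_betw_imp_surj_on)
  moreover have "E (image_cgraph f H) = {(w, w'). w \<in> W' \<and> w' \<in> W' \<and>
      snd ((\<rho> \<circ> ?g) w) = snd ((\<rho> \<circ> ?g) w') \<and> (fst ((\<rho> \<circ> ?g) w), fst ((\<rho> \<circ> ?g) w')) \<in> E G}"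
    unfolding E using cg gW by (auto simp: copied_graph_def)
  moreover have "vcol (image_cgraph f H) w = vcol G (fst ((\<rho> \<circ> ?g) w))" if "w \<in> W'" for w
    using cg gW[OF that] by (simp add: copied_graph_def image_cgraph_def)
  moreover have "ecol (image_cgraph f H) (w, w') = ecol G (fst ((\<rho> \<circ> ?g) w), fst ((\<rho> \<circ> ?g) w'))"
    if "(w, w') \<in> E (image_cgraph f H)" for w w'
  proof -
    have "(?g w, ?g w') \<in> E H" using that by (auto simp: E)
    then show ?thesis using cg by (simp add: image_cgraph_def V) (simp add: copied_graph_def)
  qed
  ultimately show ?thesis by (simp add: copied_graph_def)
qed

lemma reach_copied_graph:
  assumes cg: "copied_graph q G \<rho> W H" and w: "w \<in> W" and wf: "E G \<subseteq> V G \<times> V G"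
  shows "reach (E H) k w =
    {w' \<in> W. snd (\<rho> w') = snd (\<rho> w) \<and> fst (\<rho> w') \<in> reach (E G) k (fst (\<rho> w))}"
proof (induction k)
  case 0
  have "inj_on \<rho> W" using cg by (simp add: copied_graph_def bij_betw_def)
  then have "a = w" if "a \<in> W" "snd (\<rho> a) = snd (\<rho> w)" "fst (\<rho> a) = fst (\<rho> w)" for a
    using that w by (meson inj_onD prod_eqI)
  then show ?case using w by auto
next
  case (Suc k)
  have \<rho>: "bij_betw \<rho> W (V G \<times> {..<q})" using cg by (simp add: copied_graph_def)
  have EH: "(a, b) \<in> E H \<longleftrightarrow> a \<in> W \<and> b \<in> W \<and> snd (\<rho> a) = snd (\<rho> b) \<and> (fst (\<rho> a), fst (\<rho> b)) \<in> E G" for a b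
    using cg by (simp add: copied_graph_def)
  have lift: "\<exists>a\<in>W. fst (\<rho> a) = x \<and> snd (\<rho> a) = snd (\<rho> b)" if "x \<in> V G" "b \<in> W" for x b
  proof -
    have "(x, snd (\<rho> b)) \<in> \<rho> ` W"
      using that bij_betw_apply[OF \<rho> that(2)] bij_betw_imp_surj_on[OF \<rho>] by auto
    then obtain a where "a \<in> W" "\<rho> a = (x, snd (\<rho> b))" by (metis imageE)
    then show ?thesis by (intro bexI[of _ a]) auto
  qed
  have "b \<in> E H `` reach (E H) k w \<longleftrightarrow>
      b \<in> W \<and> snd (\<rho> b) = snd (\<rho> w) \<and> fst (\<rho> b) \<in> E G `` reach (E G) k (fst (\<rho> w))" for b
  proof
    assume "b \<in> E H `` reach (E H) k w"
    then show "b \<in> W \<and> snd (\<rho> b) = snd (\<rho> w) \<and> fst (\<rho> b) \<in> E G `` reach (E G) k (fst (\<rho> w))"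
      by (auto simp: Suc EH)
  next
    assume b: "b \<in> W \<and> snd (\<rho> b) = snd (\<rho> w) \<and> fst (\<rho> b) \<in> E G `` reach (E G) k (fst (\<rho> w))"
    then obtain x where x: "x \<in> reach (E G) k (fst (\<rho> w))" "(x, fst (\<rho> b)) \<in> E G" by auto
    then obtain a where "a \<in> W" "fst (\<rho> a) = x" "snd (\<rho> a) = snd (\<rho> b)"
      using lift[of x b] wf b by auto
    then show "b \<in> E H `` reach (E H) k w"
      using x b by (intro ImageI[of a]) (auto simp: Suc EH)
  qed
  then show ?case using Suc by auto
qed

lemma copied_graph_wf: "copied_graph q G \<rho> W H \<Longrightarrow> pair_wf_digraph (ugraph H)"
  by unfold_locales (auto simp: copied_graph_def)

text \<open>The covering map is an isomorphism on every ball.\<close>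

lemma rooted_iso_copied_graph:
  assumes cg: "copied_graph q G \<rho> W H" and w: "w \<in> W" and wf: "pair_wf_digraph (ugraph G)"
  shows "rooted_iso (fst \<circ> \<rho>) (gball H k w) (gball G k (fst (\<rho> w)))"
proof -
  note EG = E_subset[OF wf]
  have \<rho>: "bij_betw \<rho> W (V G \<times> {..<q})" and VH: "V H = W" using cg by (auto simp: copied_graph_def)
  have EH: "(a, b) \<in> E H \<longleftrightarrow> a \<in> W \<and> b \<in> W \<and> snd (\<rho> a) = snd (\<rho> b) \<and> (fst (\<rho> a), fst (\<rho> b)) \<in> E G" for a b
    using cg by (simp add: copied_graph_def)
  have \<rho>w: "fst (\<rho> w) \<in> V G" "snd (\<rho> w) < q" using bij_betw_apply[OF \<rho> w] by auto
  note r = reach_copied_graph[OF cg w EG, of k]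
  have inj: "inj_on (fst \<circ> \<rho>) (reach (E H) k w)"
    using \<rho> unfolding r bij_betw_def inj_on_def by (auto simp: prod_eq_iff)
  have "(fst \<circ> \<rho>) ` reach (E H) k w = reach (E G) k (fst (\<rho> w))"
  proof (intro equalityI subsetI)
    fix x assume x: "x \<in> reach (E G) k (fst (\<rho> w))"
    then have "(x, snd (\<rho> w)) \<in> \<rho> ` W"
      using reach_subset[OF EG \<rho>w(1)] \<rho>w bij_betw_imp_surj_on[OF \<rho>] by auto
    then obtain a where "a \<in> W" "\<rho> a = (x, snd (\<rho> w))" by auto
    then show "x \<in> (fst \<circ> \<rho>) ` reach (E H) k w" using x by (force simp: r)
  qed (auto simp: r)
  with inj have bij: "bij_betw (fst \<circ> \<rho>) (reach (E H) k w) (reach (E G) k (fst (\<rho> w)))"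
    by (simp add: bij_betw_def)
  have sub: "a \<in> W" "snd (\<rho> a) = snd (\<rho> w)" "fst (\<rho> a) \<in> reach (E G) k (fst (\<rho> w))"
    if "a \<in> reach (E H) k w" for a using that by (auto simp: r)
  have vc: "vcol H a = vcol G (fst (\<rho> a))" if "a \<in> W" for a
    using cg that by (simp add: copied_graph_def)
  have ec: "ecol H (a, b) = ecol G (fst (\<rho> a), fst (\<rho> b))" if "(a, b) \<in> E H" for a b
    using cg that unfolding copied_graph_def by blast
  have e: "(a, b) \<in> E H \<longleftrightarrow> (fst (\<rho> a), fst (\<rho> b)) \<in> E G"
    if "a \<in> reach (E H) k w" "b \<in> reach (E H) k w" for a b
    using sub(1,2)[OF that(1)] sub(1,2)[OF that(2)] by (simp add: EH)
  show ?thesis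
    unfolding gball_eq[OF copied_graph_wf[OF cg], unfolded VH, OF w] gball_eq[OF wf \<rho>w(1)]
    using bij by (auto simp: rooted_iso_def e vc ec sub)
qed

section \<open>Consequences of a small geometric distance\<close>

lemma delta_rho_less_imp:
  fixes G :: "('v, 'x, 's) cgraph" and H :: "('w, 'x, 's) cgraph"
  assumes G: "pair_wf_digraph (ugraph G)" "finite (V G)" "V G \<noteq> {}"
    and H: "pair_wf_digraph (ugraph H)" "finite (V H)" "V H \<noteq> {}"
    and less: "delta_rho G H < \<epsilon>"
  obtains q r \<rho> \<rho>' and W :: "nat set" and K K' where
    "copied_graph q G \<rho> W K" "copied_graph r H \<rho>' W K'" "finite W" "W \<noteq> {}"
    "real (card {y\<in>W. \<not> same_cgraph (star K y) (star K' y)}) < \<epsilon> * real (card W)"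
proof -
  let ?P = "\<lambda>q r \<phi> \<psi>. 0 < q \<and> 0 < r \<and> q * card (V G) = r * card (V H) \<and>
     bij_betw \<phi> (V (copies q G)) {..<q * card (V G)} \<and>
     bij_betw \<psi> (V (copies r H)) {..<q * card (V G)}"
  have Vc: "V (copies q G') = V G' \<times> {..<q}" for q and G' :: "('z, 'x, 's) cgraph"
    by (simp add: copies_def)
  have "\<exists>q r \<phi> \<psi>. ?P q r \<phi> \<psi>"
  proof -
    have card: "card (V G) > 0" "card (V H) > 0" using G H by (auto simp: card_gt_0_iff)
    have "\<exists>f. bij_betw f (V (copies (card (V H)) G)) {..<card (V H) * card (V G)}"
      using G H by (intro finite_same_card_bij) (auto simp: Vc card_cartesian_product mult.commute)
    moreover have "\<exists>f. bij_betw f (V (copies (card (V G)) H)) {..<card (V H) * card (V G)}"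
      using G H by (intro finite_same_card_bij) (auto simp: Vc card_cartesian_product mult.commute)
    ultimately show ?thesis using card
      by (intro exI[of _ "card (V H)"] exI[of _ "card (V G)"]) (auto simp: mult.commute)
  qed
  then have ne: "{delta_s (image_cgraph \<phi> (copies q G)) (image_cgraph \<psi> (copies r H)) | q r \<phi> \<psi>.
     ?P q r \<phi> \<psi>} \<noteq> {}" by blast
  obtain q r \<phi> \<psi> where P: "?P q r \<phi> \<psi>"
    and ds: "delta_s (image_cgraph \<phi> (copies q G)) (image_cgraph \<psi> (copies r H)) < \<epsilon>"
    using cInf_lessD[OF ne less[unfolded delta_rho_def]] by blast
  define W where "W = {..<q * card (V G)}"
  define K where "K = image_cgraph \<phi> (copies q G)"
  define L where "L = image_cgraph \<psi> (copies r H)"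
  have "card (V G) > 0" using G by (simp add: card_gt_0_iff)
  then have "q * card (V G) > 0" using P by (metis nat_0_less_mult_iff)
  then have "0 \<in> W" by (simp add: W_def)
  then have W: "finite W" "W \<noteq> {}" by (simp add: W_def, blast)
  have K: "copied_graph q G (id \<circ> the_inv_into (V (copies q G)) \<phi>) W K"
    unfolding K_def by (rule copied_graph_image[OF copied_graph_copies[OF E_subset[OF G(1)]]])
      (use P in \<open>unfold W_def, blast\<close>)
  have L: "copied_graph r H (id \<circ> the_inv_into (V (copies r H)) \<psi>) W L"
    unfolding L_def by (rule copied_graph_image[OF copied_graph_copies[OF E_subset[OF H(1)]]])
      (use P in \<open>unfold W_def, blast\<close>)
  have VK: "V K = W" using K by (simp add: copied_graph_def)
  have "{delta K (image_cgraph \<sigma> L) | \<sigma>. \<sigma> permutes V K} \<noteq> {}"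
    using permutes_id by blast
  from cInf_lessD[OF this] ds obtain \<sigma> where \<sigma>: "\<sigma> permutes W"
    and d: "delta K (image_cgraph \<sigma> L) < \<epsilon>"
    unfolding delta_s_def K_def[symmetric] L_def[symmetric] VK by blast
  have "copied_graph r H ((id \<circ> the_inv_into (V (copies r H)) \<psi>) \<circ> the_inv_into W \<sigma>) W (image_cgraph \<sigma> L)"
    using copied_graph_image[OF L permutes_imp_bij[OF \<sigma>]] .
  moreover have "real (card {y\<in>W. \<not> same_cgraph (star K y) (star (image_cgraph \<sigma> L) y)}) < \<epsilon> * real (card W)"
    using d W by (simp add: delta_def VK card_gt_0_iff divide_less_eq)
  ultimately show thesis using that K W by blast
qed

lemma same_starD:
  assumes "same_cgraph (star K y) (star K' y)"
  shows "E K `` {y} = E K' `` {y}" "vcol K y = vcol K' y"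
    "\<And>z. (y, z) \<in> E K \<Longrightarrow> ecol K (y, z) = ecol K' (y, z)"
proof -
  have "{(u, v) \<in> E K. u = y \<or> v = y} = {(u, v) \<in> E K'. u = y \<or> v = y}"
    using assms by (simp add: same_cgraph_def star_def)
  from arg_cong[OF this, of "\<lambda>A. (y, z) \<in> A" for z]
  have "(y, z) \<in> E K \<longleftrightarrow> (y, z) \<in> E K'" for z by simp
  then show "E K `` {y} = E K' `` {y}" by blast
  show "vcol K y = vcol K' y" using assms by (simp add: same_cgraph_def star_def)
  show "ecol K (y, z) = ecol K' (y, z)" if "(y, z) \<in> E K" for z
    using assms that by (auto simp: same_cgraph_def star_def)
qed

lemma same_stars_imp_rooted_iso_gball:
  assumes wf: "pair_wf_digraph (ugraph K)" "pair_wf_digraph (ugraph K')" and w: "w \<in> V K" "w \<in> V K'"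
    and same: "\<And>y. y \<in> reach (E K) k w \<Longrightarrow> same_cgraph (star K y) (star K' y)"
  shows "reach (E K) k w = reach (E K') k w" "rooted_iso id (gball K k w) (gball K' k w)"
proof -
  note D = same_starD[OF same]
  show eq: "reach (E K) k w = reach (E K') k w" by (rule reach_cong[OF D(1)])
  have "(u, v) \<in> E K \<longleftrightarrow> (u, v) \<in> E K'" if "u \<in> reach (E K) k w" for u v
    using D(1)[OF that] by blast
  then show "rooted_iso id (gball K k w) (gball K' k w)"
    unfolding gball_eq[OF wf(1) w(1)] gball_eq[OF wf(2) w(2)] eq[symmetric]
    using D(2,3) by (auto simp: rooted_iso_def)
qed

text \<open>
  The form in which a small geometric distance is used. Copies of \<open>G\<close> and of \<open>H\<close> share the vertex
  set \<open>W\<close>, with projections given by \<open>\<rho>\<close> and \<open>\<rho>'\<close>; outside the exceptional set \<open>R\<close>, which makes up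
  at most the fraction \<open>c\<close> of \<open>W\<close>, a vertex has the same \<open>k\<close>-ball \<open>\<beta>\<close> in both. The last four conditions
  on \<open>\<beta>\<close> say that its vertex set is the lift of the \<open>k\<close>-ball of \<open>G\<close> as well as that of \<open>H\<close>, and
  that both projections are isomorphisms on it.
\<close>

definition ball_matching ::
  "nat \<Rightarrow> real \<Rightarrow> ('v, 'x, 's) cgraph \<Rightarrow> ('w, 'x, 's) cgraph \<Rightarrow>
    nat set \<Rightarrow> nat set \<Rightarrow> nat \<Rightarrow> nat \<Rightarrow> (nat \<Rightarrow> 'v \<times> nat) \<Rightarrow> (nat \<Rightarrow> 'w \<times> nat) \<Rightarrow> bool" where
  "ball_matching k c G H W R q r \<rho> \<rho>' \<longleftrightarrow> finite W \<and> W \<noteq> {} \<and>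
     bij_betw \<rho> W (V G \<times> {..<q}) \<and> bij_betw \<rho>' W (V H \<times> {..<r}) \<and>
     R \<subseteq> W \<and> real (card R) \<le> c * real (card W) \<and>
     (\<forall>w\<in>W - R. \<exists>\<beta> :: (nat, 'x, 's) rooted. snd \<beta> \<in> V (fst \<beta>) \<and> E (fst \<beta>) \<subseteq> V (fst \<beta>) \<times> V (fst \<beta>) \<and>
        V (fst \<beta>) = {w'\<in>W. snd (\<rho> w') = snd (\<rho> w) \<and> gdist G (fst (\<rho> w)) (fst (\<rho> w')) \<le> enat k} \<and>
        V (fst \<beta>) = {w'\<in>W. snd (\<rho>' w') = snd (\<rho>' w) \<and> gdist H (fst (\<rho>' w)) (fst (\<rho>' w')) \<le> enat k} \<and>
        rooted_iso (fst \<circ> \<rho>) \<beta> (gball G k (fst (\<rho> w))) \<and>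
        rooted_iso (fst \<circ> \<rho>') \<beta> (gball H k (fst (\<rho>' w))))"

lemma copied_graph_sym: "copied_graph q G \<rho> W K \<Longrightarrow> sym (E G) \<Longrightarrow> sym (E K)"
  by (auto simp: copied_graph_def sym_def)

lemma copied_graph_degree:
  assumes cg: "copied_graph q G \<rho> W K" and deg: "deg_le d G" and fin: "finite (E G)" "finite W"
  shows "finite (E K `` {v})" "card (E K `` {v}) \<le> d"
proof -
  have EW: "E K \<subseteq> W \<times> W" using cg by (auto simp: copied_graph_def)
  then have "E K `` {v} \<subseteq> W" by auto
  then show fK: "finite (E K `` {v})" using fin(2) by (rule finite_subset)
  show "card (E K `` {v}) \<le> d"
  proof (cases "v \<in> W")
    case True
    have \<rho>: "bij_betw \<rho> W (V G \<times> {..<q})" using cg by (simp add: copied_graph_def)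
    let ?x = "fst (\<rho> v)"
    let ?f = "\<lambda>w. (?x, fst (\<rho> w))"
    have "card (E K `` {v}) \<le> card (out_arcs (with_proj (ugraph G)) ?x)"
    proof (rule card_inj_on_le[of ?f])
      show "inj_on ?f (E K `` {v})"
      proof (rule inj_onI)
        fix a b assume ab: "a \<in> E K `` {v}" "b \<in> E K `` {v}" "?f a = ?f b"
        then have "\<rho> a = \<rho> b" "a \<in> W" "b \<in> W" using cg by (auto simp: copied_graph_def prod_eq_iff)
        then show "a = b" using \<rho> by (auto simp: bij_betw_def dest: inj_onD)
      qed
      show "?f ` (E K `` {v}) \<subseteq> out_arcs (with_proj (ugraph G)) ?x"
        using cg by (auto simp: copied_graph_def out_arcs_def)
      show "finite (out_arcs (with_proj (ugraph G)) ?x)" using fin(1) by (simp add: out_arcs_def)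
    qed
    also have "\<dots> \<le> d" using deg bij_betw_apply[OF \<rho> True] by (auto simp: deg_le_def out_degree_def)
    finally show ?thesis .
  next
    case False
    then have "E K `` {v} = {}" using EW by auto
    then show ?thesis by simp
  qed
qed

text \<open>
  Balls of radius \<open>k\<close> can differ only around vertices within distance \<open>k\<close> of a vertex whose stars
  differ, and each such vertex has at most \<open>(d + 1) ^ k\<close> vertices within distance \<open>k\<close>.
\<close>

lemma delta_rho_less_imp_ball_matching:
  fixes G :: "('v, 'x, 's) cgraph" and H :: "('w, 'x, 's) cgraph"
  assumes G: "pair_graph (ugraph G)" "V G \<noteq> {}" "deg_le d G"
    and H: "pair_graph (ugraph H)" "V H \<noteq> {}"
    and less: "delta_rho G H < \<epsilon>"
  obtains W R q r \<rho> \<rho>' where "ball_matching k (\<epsilon> * real ((d + 1) ^ k)) G H W R q r \<rho> \<rho>'"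
proof -
  interpret G: pair_graph "ugraph G" by fact
  interpret H: pair_graph "ugraph H" by fact
  have wf: "pair_wf_digraph (ugraph G)" "pair_wf_digraph (ugraph H)" by unfold_locales
  obtain q r \<rho> \<rho>' and W :: "nat set" and K K' where
    K: "copied_graph q G \<rho> W K" and K': "copied_graph r H \<rho>' W K'" and W: "finite W" "W \<noteq> {}"
    and bad: "real (card {y\<in>W. \<not> same_cgraph (star K y) (star K' y)}) < \<epsilon> * real (card W)"
    using delta_rho_less_imp[OF wf(1) G.pair_finite_verts G(2) wf(2) H.pair_finite_verts H(2) less] .
  define Bad where "Bad = {y\<in>W. \<not> same_cgraph (star K y) (star K' y)}"
  \<comment> \<open>The vertices within distance \<open>k\<close> of a vertex with differing stars.\<close>
  define R where "R = (\<Union>y\<in>Bad. reach (E K) k y)"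
  have symK: "sym (E K)"
    using G.arcs_symmetric by (intro copied_graph_sym[OF K]) (auto simp: sym_def)
  have VK: "V K = W" "V K' = W" and \<rho>: "bij_betw \<rho> W (V G \<times> {..<q})" "bij_betw \<rho>' W (V H \<times> {..<r})"
    using K K' by (simp_all add: copied_graph_def)
  note wfK = copied_graph_wf[OF K] copied_graph_wf[OF K']
  have finBad: "finite Bad" using W by (simp add: Bad_def)
  have "card R \<le> (\<Sum>y\<in>Bad. card (reach (E K) k y))" unfolding R_def by (rule card_UN_le[OF finBad])
  also have "\<dots> \<le> (\<Sum>y\<in>Bad. (d + 1) ^ k)"
    by (intro sum_mono card_reach_le copied_graph_degree[OF K G(3) G.pair_finite_arcs W(1)])
  finally have "real (card R) \<le> real (card Bad * (d + 1) ^ k)" by (simp only: of_nat_le_iff sum_constant of_nat_id)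
  also have "\<dots> \<le> \<epsilon> * real (card W) * real ((d + 1) ^ k)"
    unfolding of_nat_mult using bad by (intro mult_right_mono) (auto simp: Bad_def)
  finally have card: "real (card R) \<le> \<epsilon> * real ((d + 1) ^ k) * real (card W)" by (simp add: mult_ac)
  have RW: "R \<subseteq> W"
    using reach_subset[OF E_subset[OF wfK(1)]] by (auto simp: R_def Bad_def VK)
  have "ball_matching k (\<epsilon> * real ((d + 1) ^ k)) G H W R q r \<rho> \<rho>'"
    unfolding ball_matching_def
  proof (intro conjI W \<rho> RW card ballI)
    fix w assume w: "w \<in> W - R"
    then have wW: "w \<in> W" by simp
    have same: "same_cgraph (star K y) (star K' y)" if y: "y \<in> reach (E K) k w" for y
    proof (rule ccontr)
      assume "\<not> ?thesis"
      moreover have "y \<in> W" using y reach_subset[OF E_subset[OF wfK(1)], of w k] wW by (auto simp: VK)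
      ultimately have "y \<in> Bad" by (simp add: Bad_def)
      moreover have "w \<in> reach (E K) k y" using y reach_sym[OF symK] by blast
      ultimately show False using w by (auto simp: R_def)
    qed
    note iso = same_stars_imp_rooted_iso_gball[OF wfK, unfolded VK, OF wW wW same]
    let ?\<beta> = "gball K k w"
    have \<beta>: "?\<beta> = (K \<lparr> ugraph := \<lparr> pverts = reach (E K) k w,
        parcs = E K \<inter> reach (E K) k w \<times> reach (E K) k w \<rparr> \<rparr>, w)"
      using gball_eq[OF wfK(1)] wW by (simp add: VK)
    have mem: "fst (\<rho> x) \<in> V G" "fst (\<rho>' x) \<in> V H" if "x \<in> W" for x
      using bij_betw_apply[OF \<rho>(1) that] bij_betw_apply[OF \<rho>(2) that] by auto
    show "\<exists>\<beta> :: (nat, 'x, 's) rooted. snd \<beta> \<in> V (fst \<beta>) \<and> E (fst \<beta>) \<subseteq> V (fst \<beta>) \<times> V (fst \<beta>) \<and>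
        V (fst \<beta>) = {w'\<in>W. snd (\<rho> w') = snd (\<rho> w) \<and> gdist G (fst (\<rho> w)) (fst (\<rho> w')) \<le> enat k} \<and>
        V (fst \<beta>) = {w'\<in>W. snd (\<rho>' w') = snd (\<rho>' w) \<and> gdist H (fst (\<rho>' w)) (fst (\<rho>' w')) \<le> enat k} \<and>
        rooted_iso (fst \<circ> \<rho>) \<beta> (gball G k (fst (\<rho> w))) \<and>
        rooted_iso (fst \<circ> \<rho>') \<beta> (gball H k (fst (\<rho>' w)))"
    proof (intro exI[of _ ?\<beta>] conjI)
      show "snd ?\<beta> \<in> V (fst ?\<beta>)" by (simp add: \<beta> self_in_reach)
      show sub: "E (fst ?\<beta>) \<subseteq> V (fst ?\<beta>) \<times> V (fst ?\<beta>)" by (auto simp: \<beta>)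
      have "V (fst ?\<beta>) = reach (E K) k w" by (simp add: \<beta>)
      then show "V (fst ?\<beta>) = {w'\<in>W. snd (\<rho> w') = snd (\<rho> w) \<and> gdist G (fst (\<rho> w)) (fst (\<rho> w')) \<le> enat k}"
        using gdist_le_iff[OF wf(1) mem(1)[OF wW]] reach_copied_graph[OF K wW E_subset[OF wf(1)]] by simp
      have "V (fst ?\<beta>) = reach (E K') k w" using iso(1) by (simp add: \<beta>)
      then show "V (fst ?\<beta>) = {w'\<in>W. snd (\<rho>' w') = snd (\<rho>' w) \<and> gdist H (fst (\<rho>' w)) (fst (\<rho>' w')) \<le> enat k}"
        using gdist_le_iff[OF wf(2) mem(2)[OF wW]] reach_copied_graph[OF K' wW E_subset[OF wf(2)]] by simp
      show "rooted_iso (fst \<circ> \<rho>) ?\<beta> (gball G k (fst (\<rho> w)))"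
        by (rule rooted_iso_copied_graph[OF K wW wf(1)])
      show "rooted_iso (fst \<circ> \<rho>') ?\<beta> (gball H k (fst (\<rho>' w)))"
        using rooted_iso_trans[OF iso(2) rooted_iso_copied_graph[OF K' wW wf(2)] sub] by simp
    qed
  qed
  then show thesis by (rule that)
qed

section \<open>Transfer along matched balls\<close>

lemma ball_typesD:
  assumes "\<alpha> \<in> ball_types d k X S"
  shows "E (fst \<alpha>) \<subseteq> V (fst \<alpha>) \<times> V (fst \<alpha>)"
proof -
  have "pair_graph (ugraph (fst \<alpha>))" using assms by (auto simp: ball_types_def xs_graph_def)
  then interpret pair_graph "ugraph (fst \<alpha>)" .
  show ?thesis by (rule E_subset) unfold_locales
qed

text \<open>
  An identification of a ball of \<open>G\<close> with \<open>\<alpha>\<close> induces one of the matched ball of \<open>H\<close>, such that the two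
  points below a vertex of \<open>W\<close> correspond to the same vertex of \<open>\<alpha>\<close>.
\<close>

lemma ball_matching_transfer:
  fixes G :: "('v, 'x, 's) cgraph" and H :: "('w, 'x, 's) cgraph"
  assumes bm: "ball_matching k c G H W R q r \<rho> \<rho>'" and w: "w \<in> W - R"
    and wf: "pair_wf_digraph (ugraph G)"
    and \<phi>: "rooted_iso \<phi> \<alpha> (gball G k (fst (\<rho> w)))" and \<alpha>: "E (fst \<alpha>) \<subseteq> V (fst \<alpha>) \<times> V (fst \<alpha>)"
  shows "\<exists>\<phi>'. rooted_iso \<phi>' \<alpha> (gball H k (fst (\<rho>' w))) \<and>
    (\<forall>w'\<in>W. snd (\<rho> w') = snd (\<rho> w) \<and> gdist G (fst (\<rho> w)) (fst (\<rho> w')) \<le> enat k \<longrightarrow>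
      (\<exists>v\<in>V (fst \<alpha>). \<phi> v = fst (\<rho> w') \<and> \<phi>' v = fst (\<rho>' w')))"
proof -
  obtain \<beta> :: "(nat, 'x, 's) rooted" where
    \<beta>: "snd \<beta> \<in> V (fst \<beta>)" "E (fst \<beta>) \<subseteq> V (fst \<beta>) \<times> V (fst \<beta>)" and
    V\<beta>: "V (fst \<beta>) = {w'\<in>W. snd (\<rho> w') = snd (\<rho> w) \<and> gdist G (fst (\<rho> w)) (fst (\<rho> w')) \<le> enat k}" and
    iso: "rooted_iso (fst \<circ> \<rho>) \<beta> (gball G k (fst (\<rho> w)))" "rooted_iso (fst \<circ> \<rho>') \<beta> (gball H k (fst (\<rho>' w)))"
    using bm w unfolding ball_matching_def by blast
  have \<rho>: "bij_betw \<rho> W (V G \<times> {..<q})" using bm by (simp add: ball_matching_def)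
  have x: "fst (\<rho> w) \<in> V G" using bij_betw_apply[OF \<rho>, of w] w by auto
  let ?B = "gball G k (fst (\<rho> w))"
  have EB: "E (fst ?B) \<subseteq> V (fst ?B) \<times> V (fst ?B)" by (auto simp: gball_eq[OF wf x])
  let ?\<theta> = "the_inv_into (V (fst \<beta>)) (fst \<circ> \<rho>)"
  have \<theta>: "rooted_iso ?\<theta> ?B \<beta>" by (rule rooted_iso_sym[OF iso(1) \<beta>(1) EB])
  have \<phi>': "rooted_iso ((fst \<circ> \<rho>') \<circ> (?\<theta> \<circ> \<phi>)) \<alpha> (gball H k (fst (\<rho>' w)))"
    by (rule rooted_iso_trans[OF rooted_iso_trans[OF \<phi> \<theta> \<alpha>] iso(2) \<alpha>])
  have bij: "bij_betw (fst \<circ> \<rho>) (V (fst \<beta>)) (V (fst ?B))" "bij_betw \<phi> (V (fst \<alpha>)) (V (fst ?B))"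
    using iso(1) \<phi> by (simp_all add: rooted_iso_def Let_def)
  have "\<exists>v\<in>V (fst \<alpha>). \<phi> v = fst (\<rho> w') \<and> ((fst \<circ> \<rho>') \<circ> (?\<theta> \<circ> \<phi>)) v = fst (\<rho>' w')"
    if w': "w' \<in> V (fst \<beta>)" for w'
  proof -
    have "fst (\<rho> w') \<in> V (fst ?B)" using bij_betw_apply[OF bij(1) w'] by simp
    then obtain v where v: "v \<in> V (fst \<alpha>)" "\<phi> v = fst (\<rho> w')"
      using bij_betw_imp_surj_on[OF bij(2)] by (metis imageE)
    have "?\<theta> (fst (\<rho> w')) = w'"
      using the_inv_into_f_f[OF bij_betw_imp_inj_on[OF bij(1)] w'] by simp
    then show ?thesis using v by (intro bexI[of _ v]) auto
  qed
  then show ?thesis using \<phi>' V\<beta> by blast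
qed

lemma card_preimage_copies:
  fixes q :: nat
  assumes \<rho>: "bij_betw \<rho> W (U \<times> {..<q})" and P: "P \<subseteq> U"
  shows "card {w\<in>W. fst (\<rho> w) \<in> P} = card P * q"
proof -
  have img: "\<rho> ` {w\<in>W. fst (\<rho> w) \<in> P} = P \<times> {..<q}"
  proof (intro equalityI subsetI)
    fix p assume p: "p \<in> P \<times> {..<q}"
    then have "p \<in> \<rho> ` W" using bij_betw_imp_surj_on[OF \<rho>] P by auto
    then obtain w where "w \<in> W" "p = \<rho> w" by blast
    then show "p \<in> \<rho> ` {w\<in>W. fst (\<rho> w) \<in> P}" using p by (auto simp: mem_Times_iff)
  next
    fix p assume "p \<in> \<rho> ` {w\<in>W. fst (\<rho> w) \<in> P}"
    then obtain w where w: "w \<in> W" "fst (\<rho> w) \<in> P" "p = \<rho> w" by auto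
    then show "p \<in> P \<times> {..<q}" using bij_betw_apply[OF \<rho> w(1)] by (auto simp: mem_Times_iff)
  qed
  have "inj_on \<rho> {w\<in>W. fst (\<rho> w) \<in> P}"
    by (rule inj_on_subset[OF bij_betw_imp_inj_on[OF \<rho>]]) auto
  from card_image[OF this] show ?thesis by (simp add: img card_cartesian_product)
qed

lemma preimage_copies_fraction:
  fixes q :: nat
  assumes \<rho>: "bij_betw \<rho> W (U \<times> {..<q})" and P: "P \<subseteq> U" and W: "finite W" "W \<noteq> {}"
  shows "real (card {w\<in>W. fst (\<rho> w) \<in> P}) / real (card W) = real (card P) / real (card U)"
proof -
  have "card W = card U * q" using bij_betw_same_card[OF \<rho>] by (simp add: card_cartesian_product)
  moreover have "card W > 0" using W by (simp add: card_gt_0_iff)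
  ultimately show ?thesis using card_preimage_copies[OF \<rho> P] by auto
qed

text \<open>
  Every vertex of a graph has equally many copies, so proportions of vertices can be compared on \<open>W\<close>.
\<close>

lemma ball_matching_fraction_le:
  assumes bm: "ball_matching k c G H W R q r \<rho> \<rho>'"
    and P: "P \<subseteq> V G" "P' \<subseteq> V H"
    and tr: "\<And>w. w \<in> W - R \<Longrightarrow> fst (\<rho> w) \<in> P \<Longrightarrow> fst (\<rho>' w) \<in> P'"
  shows "real (card P) / real (card (V G)) \<le> real (card P') / real (card (V H)) + c"
proof -
  have W: "finite W" "W \<noteq> {}" and \<rho>: "bij_betw \<rho> W (V G \<times> {..<q})" "bij_betw \<rho>' W (V H \<times> {..<r})"
    and R: "R \<subseteq> W" "real (card R) \<le> c * real (card W)"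
    using bm by (auto simp: ball_matching_def)
  have pos: "real (card W) > 0" using W by (simp add: card_gt_0_iff)
  have finR: "finite R" using R(1) W(1) by (rule finite_subset)
  have "{w\<in>W. fst (\<rho> w) \<in> P} \<subseteq> {w\<in>W. fst (\<rho>' w) \<in> P'} \<union> R" using tr by auto
  then have "card {w\<in>W. fst (\<rho> w) \<in> P} \<le> card ({w\<in>W. fst (\<rho>' w) \<in> P'} \<union> R)"
    using W(1) finR by (intro card_mono) auto
  also have "\<dots> \<le> card {w\<in>W. fst (\<rho>' w) \<in> P'} + card R" by (rule card_Un_le)
  finally have "real (card {w\<in>W. fst (\<rho> w) \<in> P}) \<le> real (card {w\<in>W. fst (\<rho>' w) \<in> P'}) + c * real (card W)"
    using R(2) by linarith
  then have "real (card {w\<in>W. fst (\<rho> w) \<in> P}) / real (card W) \<le>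
      real (card {w\<in>W. fst (\<rho>' w) \<in> P'}) / real (card W) + c"
    using pos by (simp add: field_simps)
  then show ?thesis
    unfolding preimage_copies_fraction[OF \<rho>(1) P(1) W] preimage_copies_fraction[OF \<rho>(2) P(2) W] .
qed

text \<open>The vertices whose \<open>k\<close>-ball represents \<open>\<alpha>\<close>.\<close>

definition occurrences :: "('v, 'x, 's) cgraph \<Rightarrow> nat \<Rightarrow> (nat, 'x, 's) rooted \<Rightarrow> 'v set" where
  "occurrences G k \<alpha> = {z \<in> V G. \<exists>\<phi>. rooted_iso \<phi> \<alpha> (gball G k z)}"

lemma ball_freq_occurrences: "ball_freq G k \<alpha> = real (card (occurrences G k \<alpha>)) / real (card (V G))"
  by (simp add: ball_freq_def occurrences_def)

lemma ball_matching_occurrences: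
  assumes bm: "ball_matching k c G H W R q r \<rho> \<rho>'" and wf: "pair_wf_digraph (ugraph G)"
    and \<alpha>: "\<alpha> \<in> ball_types d k X S"
    and w: "w \<in> W - R" "fst (\<rho> w) \<in> occurrences G k \<alpha>"
  shows "fst (\<rho>' w) \<in> occurrences H k \<alpha>"
proof -
  have "bij_betw \<rho>' W (V H \<times> {..<r})" using bm by (simp add: ball_matching_def)
  then have "fst (\<rho>' w) \<in> V H" using w(1) bij_betw_apply by fastforce
  moreover obtain \<phi> where "rooted_iso \<phi> \<alpha> (gball G k (fst (\<rho> w)))"
    using w(2) by (auto simp: occurrences_def)
  ultimately show ?thesis
    using ball_matching_transfer[OF bm w(1) wf _ ball_typesD[OF \<alpha>]] by (auto simp: occurrences_def)
qed

text \<open>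
  Outside the exceptional set, and over a vertex whose ball has a type \<open>\<alpha>\<close> on which both kernels are
  given by the same pattern \<open>f\<close>, the rows of the two copied kernels agree: on the common ball both are
  read off from \<open>f\<close>, and off the ball both vanish.
\<close>

lemma copied_kernels_agree:
  fixes G :: "('v, 'x, 's) cgraph" and H :: "('w, 'x, 's) cgraph"
  assumes bm: "ball_matching k c G H W R q r \<rho> \<rho>'" and wf: "pair_wf_digraph (ugraph G)"
    and \<alpha>: "\<alpha> \<in> ball_types d k X S"
    and w: "w \<in> W - R" "fst (\<rho> w) \<in> occurrences G k \<alpha>" and w': "w' \<in> W"
    and far: "\<And>x y. x \<in> V G \<Longrightarrow> y \<in> V G \<Longrightarrow> gdist G x y > enat k \<Longrightarrow> A x y = 0"
    and far': "\<And>x y. x \<in> V H \<Longrightarrow> y \<in> V H \<Longrightarrow> gdist H x y > enat k \<Longrightarrow> A' x y = 0"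
    and f: "\<And>x \<phi> v. x \<in> V G \<Longrightarrow> rooted_iso \<phi> \<alpha> (gball G k x) \<Longrightarrow> v \<in> V (fst \<alpha>) \<Longrightarrow> A x (\<phi> v) = f v"
    and f': "\<And>x \<phi> v. x \<in> V H \<Longrightarrow> rooted_iso \<phi> \<alpha> (gball H k x) \<Longrightarrow> v \<in> V (fst \<alpha>) \<Longrightarrow> A' x (\<phi> v) = f v"
  shows "copied_kernel \<rho> A w w' = copied_kernel \<rho>' A' w w'"
proof -
  have \<rho>: "bij_betw \<rho> W (V G \<times> {..<q})" "bij_betw \<rho>' W (V H \<times> {..<r})"
    using bm by (auto simp: ball_matching_def)
  have mem: "fst (\<rho> x) \<in> V G" "fst (\<rho>' x) \<in> V H" if "x \<in> W" for x
    using bij_betw_apply[OF \<rho>(1) that] bij_betw_apply[OF \<rho>(2) that] by auto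
  have wW: "w \<in> W" using w by simp
  let ?near = "snd (\<rho> w') = snd (\<rho> w) \<and> gdist G (fst (\<rho> w)) (fst (\<rho> w')) \<le> enat k"
  obtain \<beta> :: "(nat, 'x, 's) rooted" where
    "V (fst \<beta>) = {w'\<in>W. snd (\<rho> w') = snd (\<rho> w) \<and> gdist G (fst (\<rho> w)) (fst (\<rho> w')) \<le> enat k}"
    "V (fst \<beta>) = {w'\<in>W. snd (\<rho>' w') = snd (\<rho>' w) \<and> gdist H (fst (\<rho>' w)) (fst (\<rho>' w')) \<le> enat k}"
    using bm w(1) unfolding ball_matching_def by blast
  from arg_cong[OF trans[OF this(1)[symmetric] this(2)], of "\<lambda>A. w' \<in> A"] w'
  have near: "?near \<longleftrightarrow> snd (\<rho>' w') = snd (\<rho>' w) \<and> gdist H (fst (\<rho>' w)) (fst (\<rho>' w')) \<le> enat k"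
    by simp
  show ?thesis
  proof (cases ?near)
    case True
    obtain \<phi> where \<phi>: "rooted_iso \<phi> \<alpha> (gball G k (fst (\<rho> w)))"
      using w(2) by (auto simp: occurrences_def)
    obtain \<phi>' v where \<phi>': "rooted_iso \<phi>' \<alpha> (gball H k (fst (\<rho>' w)))"
      and v: "v \<in> V (fst \<alpha>)" "\<phi> v = fst (\<rho> w')" "\<phi>' v = fst (\<rho>' w')"
      using ball_matching_transfer[OF bm w(1) wf \<phi> ball_typesD[OF \<alpha>]] w' True by blast
    have "A (fst (\<rho> w)) (fst (\<rho> w')) = A' (fst (\<rho>' w)) (fst (\<rho>' w'))"
      using f[OF mem(1)[OF wW] \<phi> v(1)] f'[OF mem(2)[OF wW] \<phi>' v(1)] v by simp
    then show ?thesis using True near by (simp add: copied_kernel_def)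
  next
    case False
    then have "copied_kernel \<rho> A w w' = 0"
      using far[OF mem(1)[OF wW] mem(1)[OF w']] by (auto simp: copied_kernel_def not_le)
    moreover have "copied_kernel \<rho>' A' w w' = 0"
      using False near far'[OF mem(2)[OF wW] mem(2)[OF w']] by (auto simp: copied_kernel_def not_le)
    ultimately show ?thesis by simp
  qed
qed

section \<open>Strongly convergent sequences\<close>

lemma strongly_convergent_imp_ball_matching:
  fixes G :: "nat \<Rightarrow> ('v, 'x, 's) cgraph"
  assumes G: "\<And>n. pair_graph (ugraph (G n))" "\<And>n. V (G n) \<noteq> {}" "\<And>n. deg_le d (G n)"
    and sc: "strongly_convergent G" and c: "c > 0"
  shows "\<exists>N. \<forall>m\<ge>N. \<forall>n\<ge>N. \<exists>W R q r \<rho> \<rho>'. ball_matching k c (G m) (G n) W R q r \<rho> \<rho>'"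
proof -
  let ?K = "real ((d + 1) ^ k)"
  have K: "?K > 0" by (simp del: of_nat_add of_nat_power of_nat_Suc)
  then have "c / ?K > 0" using c by simp
  then obtain N where N: "\<And>m n. m \<ge> N \<Longrightarrow> n \<ge> N \<Longrightarrow> delta_rho (G m) (G n) < c / ?K"
    using sc unfolding strongly_convergent_def by blast
  have eq: "c / ?K * ?K = c" using K by (simp only: nonzero_eq_divide_eq[symmetric] less_irrefl) 
  have "\<exists>W R q r \<rho> \<rho>'. ball_matching k c (G m) (G n) W R q r \<rho> \<rho>'" if mn: "m \<ge> N" "n \<ge> N" for m n
    using delta_rho_less_imp_ball_matching[OF G(1,2,3) G(1,2) N[OF mn], of k] unfolding eq by metis
  then show ?thesis by blast
qed

lemma strongly_convergent_imp_convergent_ball_freq: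
  fixes G :: "nat \<Rightarrow> ('v, 'x, 's) cgraph"
  assumes G: "\<And>n. pair_graph (ugraph (G n))" "\<And>n. V (G n) \<noteq> {}" "\<And>n. deg_le d (G n)"
    and sc: "strongly_convergent G" and \<alpha>: "\<alpha> \<in> ball_types d k X S"
  shows "convergent (\<lambda>n. ball_freq (G n) k \<alpha>)"
proof (rule Cauchy_convergent, rule metric_CauchyI)
  fix e :: real assume e: "e > 0"
  have wf: "pair_wf_digraph (ugraph (G n))" for n
  proof -
    interpret pair_graph "ugraph (G n)" by (rule G(1))
    show ?thesis by unfold_locales
  qed
  obtain N where N: "\<And>m n. m \<ge> N \<Longrightarrow> n \<ge> N \<Longrightarrow> \<exists>W R q r \<rho> \<rho>'. ball_matching k (e / 2) (G m) (G n) W R q r \<rho> \<rho>'"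
    using strongly_convergent_imp_ball_matching[OF G sc, of "e / 2" k] e by (meson half_gt_zero)
  have le: "ball_freq (G m) k \<alpha> \<le> ball_freq (G n) k \<alpha> + e / 2" if mn: "m \<ge> N" "n \<ge> N" for m n
  proof -
    obtain W R q r \<rho> \<rho>' where bm: "ball_matching k (e / 2) (G m) (G n) W R q r \<rho> \<rho>'"
      using N[OF mn] by blast
    show ?thesis
      unfolding ball_freq_occurrences
      by (rule ball_matching_fraction_le[OF bm _ _ ball_matching_occurrences[OF bm wf \<alpha>]])
        (auto simp: occurrences_def)
  qed
  show "\<exists>M. \<forall>m\<ge>M. \<forall>n\<ge>M. dist (ball_freq (G m) k \<alpha>) (ball_freq (G n) k \<alpha>) < e"
  proof (intro exI[of _ N] allI impI)
    fix m n assume "m \<ge> N" "n \<ge> N"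
    then show "dist (ball_freq (G m) k \<alpha>) (ball_freq (G n) k \<alpha>) < e"
      using le[of m n] le[of n m] e by (simp add: dist_real_def abs_less_iff)
  qed
qed

text \<open>
  The candidates are the types of the balls of a single graph \<open>G M\<close> far out in the sequence, which are
  finitely many. In later graphs all but the fraction \<open>c\<close> of the vertices have one of these types, and
  the candidates with limit frequency zero together eventually take up at most another fraction \<open>c\<close>.
\<close>

lemma exists_typical_ball_types:
  fixes G :: "nat \<Rightarrow> ('v, 'x, 's) cgraph"
  assumes xs: "\<And>n. xs_graph X S (G n)" and ne: "\<And>n. V (G n) \<noteq> {}" and deg: "\<And>n. deg_le d (G n)"
    and sc: "strongly_convergent G" and c: "c > 0"
  obtains T N where "T \<subseteq> ball_types d k X S"
    "\<And>\<alpha>. \<alpha> \<in> T \<Longrightarrow> \<exists>L. (\<lambda>n. ball_freq (G n) k \<alpha>) \<longlonglongrightarrow> L \<and> L \<noteq> 0"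
    "\<And>n. n \<ge> N \<Longrightarrow>
      real (card {x \<in> V (G n). x \<notin> (\<Union>\<alpha>\<in>T. occurrences (G n) k \<alpha>)}) \<le> 2 * c * real (card (V (G n)))"
proof -
  have G: "pair_graph (ugraph (G n))" for n using xs by (simp add: xs_graph_def)
  have wf: "pair_wf_digraph (ugraph (G n))" and fin: "finite (V (G n))" for n
  proof -
    interpret pair_graph "ugraph (G n)" by (rule G)
    show "pair_wf_digraph (ugraph (G n))" by unfold_locales
    show "finite (V (G n))" by (rule pair_finite_verts)
  qed
  have pos: "real (card (V (G n))) > 0" for n using fin ne by (simp add: card_gt_0_iff)
  obtain M where M: "\<And>m n. m \<ge> M \<Longrightarrow> n \<ge> M \<Longrightarrow> \<exists>W R q r \<rho> \<rho>'. ball_matching k c (G m) (G n) W R q r \<rho> \<rho>'"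
    using strongly_convergent_imp_ball_matching[OF G ne deg sc c, of k] by blast
  have "\<forall>x\<in>V (G M). \<exists>\<alpha>. \<alpha> \<in> ball_types d k X S \<and> x \<in> occurrences (G M) k \<alpha>"
    using gball_has_type[OF xs deg] by (fastforce simp: occurrences_def)
  then obtain \<tau> where \<tau>: "\<And>x. x \<in> V (G M) \<Longrightarrow> \<tau> x \<in> ball_types d k X S"
    "\<And>x. x \<in> V (G M) \<Longrightarrow> x \<in> occurrences (G M) k (\<tau> x)"
    by metis
  define T0 where "T0 = \<tau> ` V (G M)"
  have T0: "finite T0" "T0 \<subseteq> ball_types d k X S" using fin \<tau>(1) by (auto simp: T0_def)
  define lf where "lf \<alpha> = lim (\<lambda>n. ball_freq (G n) k \<alpha>)" for \<alpha>
  have lf: "(\<lambda>n. ball_freq (G n) k \<alpha>) \<longlonglongrightarrow> lf \<alpha>" if "\<alpha> \<in> T0" for \<alpha>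
    unfolding lf_def convergent_LIMSEQ_iff[symmetric]
    by (rule strongly_convergent_imp_convergent_ball_freq[OF G ne deg sc]) (use that T0 in auto)
  define Z where "Z = {\<alpha>\<in>T0. lf \<alpha> = 0}"
  have finZ: "finite Z" using T0 by (simp add: Z_def)
  have "(\<lambda>n. \<Sum>\<alpha>\<in>Z. ball_freq (G n) k \<alpha>) \<longlonglongrightarrow> (\<Sum>\<alpha>\<in>Z. lf \<alpha>)"
    by (intro tendsto_sum lf) (simp add: Z_def)
  then have "(\<lambda>n. \<Sum>\<alpha>\<in>Z. ball_freq (G n) k \<alpha>) \<longlonglongrightarrow> 0" by (simp add: Z_def)
  then have "\<forall>\<^sub>F n in sequentially. (\<Sum>\<alpha>\<in>Z. ball_freq (G n) k \<alpha>) < c"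
    using c by (rule order_tendstoD)
  then obtain N where N: "\<And>n. n \<ge> N \<Longrightarrow> (\<Sum>\<alpha>\<in>Z. ball_freq (G n) k \<alpha>) < c"
    unfolding eventually_sequentially by blast
  show thesis
  proof (rule that[of "T0 - Z" "max M N"])
    show "T0 - Z \<subseteq> ball_types d k X S" using T0 by auto
    show "\<exists>L. (\<lambda>n. ball_freq (G n) k \<alpha>) \<longlonglongrightarrow> L \<and> L \<noteq> 0" if "\<alpha> \<in> T0 - Z" for \<alpha>
      using lf[of \<alpha>] that by (auto simp: Z_def)
    fix n assume n: "n \<ge> max M N"
    define Q where "Q = V (G n) \<inter> (\<Union>\<alpha>\<in>T0. occurrences (G n) k \<alpha>)"
    obtain W R q r \<rho> \<rho>' where bm: "ball_matching k c (G M) (G n) W R q r \<rho> \<rho>'"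
      using M[of M n] n by auto
    have "real (card (V (G M))) / real (card (V (G M))) \<le> real (card Q) / real (card (V (G n))) + c"
    proof (rule ball_matching_fraction_le[OF bm])
      fix w assume w: "w \<in> W - R" "fst (\<rho> w) \<in> V (G M)"
      have "fst (\<rho>' w) \<in> occurrences (G n) k (\<tau> (fst (\<rho> w)))"
        by (rule ball_matching_occurrences[OF bm wf \<tau>(1) w(1) \<tau>(2)]) (rule w(2))+
      then show "fst (\<rho>' w) \<in> Q" using w(2) by (auto simp: Q_def T0_def occurrences_def)
    qed (auto simp: Q_def)
    then have "1 \<le> real (card Q) / real (card (V (G n))) + c" using pos[of M] by simp
    then have Q: "real (card (V (G n))) - real (card Q) \<le> c * real (card (V (G n)))"
      using pos[of n] by (simp add: field_simps)
    have QV: "Q \<subseteq> V (G n)" by (simp add: Q_def)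
    have "real (card (\<Union>\<alpha>\<in>Z. occurrences (G n) k \<alpha>)) \<le> real (\<Sum>\<alpha>\<in>Z. card (occurrences (G n) k \<alpha>))"
      using card_UN_le[OF finZ] by (simp only: of_nat_le_iff)
    also have "\<dots> = (\<Sum>\<alpha>\<in>Z. ball_freq (G n) k \<alpha>) * real (card (V (G n)))"
      using pos[of n] by (simp add: ball_freq_occurrences sum_distrib_right)
    also have "\<dots> \<le> c * real (card (V (G n)))"
      using N[of n] n by (intro mult_right_mono) auto
    finally have Z: "real (card (\<Union>\<alpha>\<in>Z. occurrences (G n) k \<alpha>)) \<le> c * real (card (V (G n)))" .
    have "{x \<in> V (G n). x \<notin> (\<Union>\<alpha>\<in>T0 - Z. occurrences (G n) k \<alpha>)} \<subseteq>
        (V (G n) - Q) \<union> (\<Union>\<alpha>\<in>Z. occurrences (G n) k \<alpha>)"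
      by (auto simp: Q_def)
    moreover have "finite (\<Union>\<alpha>\<in>Z. occurrences (G n) k \<alpha>)"
      using finZ fin[of n] by (simp add: occurrences_def)
    ultimately have "card {x \<in> V (G n). x \<notin> (\<Union>\<alpha>\<in>T0 - Z. occurrences (G n) k \<alpha>)} \<le>
        card ((V (G n) - Q) \<union> (\<Union>\<alpha>\<in>Z. occurrences (G n) k \<alpha>))"
      using fin[of n] by (intro card_mono) auto
    also have "\<dots> \<le> card (V (G n) - Q) + card (\<Union>\<alpha>\<in>Z. occurrences (G n) k \<alpha>)" by (rule card_Un_le)
    also have "card (V (G n) - Q) = card (V (G n)) - card Q"
      using QV fin[of n] by (meson card_Diff_subset finite_subset)
    finally have "real (card {x \<in> V (G n). x \<notin> (\<Union>\<alpha>\<in>T0 - Z. occurrences (G n) k \<alpha>)}) \<le>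
        (real (card (V (G n))) - real (card Q)) + real (card (\<Union>\<alpha>\<in>Z. occurrences (G n) k \<alpha>))"
      using card_mono[OF fin QV] by linarith
    then show "real (card {x \<in> V (G n). x \<notin> (\<Union>\<alpha>\<in>T0 - Z. occurrences (G n) k \<alpha>)}) \<le> 2 * c * real (card (V (G n)))"
      using Q Z by linarith
  qed
qed

section \<open>Uniform convergence of the spectral distributions\<close>

theorem proposition3p2:
  fixes X :: "'x set" and S :: "'s set" and d :: nat
    and G :: "nat \<Rightarrow> ('v, 'x, 's) cgraph"
    and B :: "nat \<Rightarrow> 'v \<Rightarrow> 'v \<Rightarrow> real"
  assumes "finite X" and "finite S"
    and "\<And>n. xs_graph X S (G n)"
    and "\<And>n. conn (G n)"
    and "\<And>n. deg_le d (G n)"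
    and "filterlim (\<lambda>n. card (V (G n))) at_top sequentially"
    and "strongly_convergent G"
    and "weakly_convergent_operators d X S G B"
    and "\<And>n. self_adjoint_on (V (G n)) (B n)"
  shows "uniformly_convergent_on UNIV (\<lambda>n. spectral_distribution (V (G n)) (B n))"
proof (rule Cauchy_uniformly_convergent, unfold uniformly_Cauchy_on_def, intro allI impI)
  fix e :: real assume e: "e > 0"
  note xs = assms(3) and deg = assms(5) and sc = assms(7) and sa = assms(9)
  have G: "pair_graph (ugraph (G n))" for n using xs by (simp add: xs_graph_def)
  have wf: "pair_wf_digraph (ugraph (G n))" and fin: "finite (V (G n))" for n
  proof -
    interpret pair_graph "ugraph (G n)" by (rule G)
    show "pair_wf_digraph (ugraph (G n))" by unfold_locales
    show "finite (V (G n))" by (rule pair_finite_verts)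
  qed
  have ne: "V (G n) \<noteq> {}" for n
    using assms(4)[of n] by (auto simp: conn_def strongly_connected_def)
  obtain s where
    far_all: "\<forall>n. \<forall>x\<in>V (G n). \<forall>y\<in>V (G n). gdist (G n) x y > enat s \<longrightarrow> B n x y = 0" and
    pattern_all: "\<forall>\<alpha>\<in>ball_types d s X S. \<forall>L. (\<lambda>n. ball_freq (G n) s \<alpha>) \<longlonglongrightarrow> L \<and> L \<noteq> 0 \<longrightarrow>
      (\<exists>f. invariant_function \<alpha> f \<and> (\<forall>n. \<forall>x\<in>V (G n). \<forall>\<phi>. rooted_iso \<phi> \<alpha> (gball (G n) s x) \<longrightarrow>
        (\<forall>v\<in>V (fst \<alpha>). B n x (\<phi> v) = f v)))"
    using assms(8) unfolding weakly_convergent_operators_def by (elim conjE exE) (rule that)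
  have far: "B n x y = 0" if "x \<in> V (G n)" "y \<in> V (G n)" "gdist (G n) x y > enat s" for n x y
    using far_all that by blast
  define c where "c = e / 4"
  have c: "c > 0" using e by (simp add: c_def)
  obtain T N where T: "T \<subseteq> ball_types d s X S"
    "\<And>\<alpha>. \<alpha> \<in> T \<Longrightarrow> \<exists>L. (\<lambda>n. ball_freq (G n) s \<alpha>) \<longlonglongrightarrow> L \<and> L \<noteq> 0"
    and N: "\<And>n. n \<ge> N \<Longrightarrow>
      real (card {x \<in> V (G n). x \<notin> (\<Union>\<alpha>\<in>T. occurrences (G n) s \<alpha>)}) \<le> 2 * c * real (card (V (G n)))"
    using exists_typical_ball_types[OF xs ne deg sc c, of s] by blast
  obtain M where M: "\<And>m n. m \<ge> M \<Longrightarrow> n \<ge> M \<Longrightarrow> \<exists>W R q r \<rho> \<rho>'. ball_matching s c (G m) (G n) W R q r \<rho> \<rho>'"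
    using strongly_convergent_imp_ball_matching[OF G ne deg sc c, of s] by blast
  have le: "spectral_distribution (V (G m)) (B m) t \<le> spectral_distribution (V (G n)) (B n) t + 3 * c"
    if mn: "m \<ge> max M N" "n \<ge> max M N" for m n t
  proof -
    obtain W R q r \<rho> \<rho>' where bm: "ball_matching s c (G m) (G n) W R q r \<rho> \<rho>'"
      using M[of m n] mn by auto
    have W: "finite W" "W \<noteq> {}" and \<rho>: "bij_betw \<rho> W (V (G m) \<times> {..<q})" "bij_betw \<rho>' W (V (G n) \<times> {..<r})"
      and R: "R \<subseteq> W" "real (card R) \<le> c * real (card W)"
      using bm by (auto simp: ball_matching_def)
    define P where "P = {x \<in> V (G m). x \<notin> (\<Union>\<alpha>\<in>T. occurrences (G m) s \<alpha>)}"
    \<comment> \<open>The vertices at which the rows of the two copied kernels may differ.\<close>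
    define R' where "R' = R \<union> {w\<in>W. fst (\<rho> w) \<in> P}"
    have PV: "P \<subseteq> V (G m)" by (auto simp: P_def)
    have pos: "real (card W) > 0" "real (card (V (G m))) > 0"
      using W fin[of m] ne[of m] by (auto simp: card_gt_0_iff)
    have "real (card P) / real (card (V (G m))) \<le> 2 * c"
      using N[of m] mn pos by (simp add: P_def divide_le_eq)
    then have "real (card {w\<in>W. fst (\<rho> w) \<in> P}) \<le> 2 * c * real (card W)"
      unfolding preimage_copies_fraction[OF \<rho>(1) PV W, symmetric] using pos by (simp add: divide_le_eq)
    moreover have "card R' \<le> card R + card {w\<in>W. fst (\<rho> w) \<in> P}"
      unfolding R'_def by (rule card_Un_le)
    ultimately have "real (card R') \<le> 3 * c * real (card W)" using R(2) by linarith
    then have R'c: "real (card R') / real (card W) \<le> 3 * c" using pos by (simp add: divide_le_eq)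
    have R'W: "R' \<subseteq> W" using R by (auto simp: R'_def)
    have "copied_kernel \<rho> (B m) w w' = copied_kernel \<rho>' (B n) w w'" if w: "w \<in> W - R'" and w': "w' \<in> W" for w w'
    proof -
      have wR: "w \<in> W - R" using w by (auto simp: R'_def)
      have "fst (\<rho> w) \<in> V (G m)" using bij_betw_apply[OF \<rho>(1), of w] wR by auto
      then obtain \<alpha> where \<alpha>: "\<alpha> \<in> T" "fst (\<rho> w) \<in> occurrences (G m) s \<alpha>"
        using w by (auto simp: R'_def P_def)
      have \<alpha>t: "\<alpha> \<in> ball_types d s X S" using \<alpha> T by auto
      obtain L where "(\<lambda>n. ball_freq (G n) s \<alpha>) \<longlonglongrightarrow> L \<and> L \<noteq> 0" using T(2)[OF \<alpha>(1)] by blast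
      from pattern_all[rule_format, OF \<alpha>t this] obtain f where
        f_all: "\<forall>n. \<forall>x\<in>V (G n). \<forall>\<phi>. rooted_iso \<phi> \<alpha> (gball (G n) s x) \<longrightarrow>
          (\<forall>v\<in>V (fst \<alpha>). B n x (\<phi> v) = f v)"
        by (elim exE conjE)
      have f: "B n x (\<phi> v) = f v"
        if "x \<in> V (G n)" "rooted_iso \<phi> \<alpha> (gball (G n) s x)" "v \<in> V (fst \<alpha>)" for n x \<phi> v
        using f_all that by blast
      from \<alpha>t show ?thesis
        by (rule copied_kernels_agree[OF bm wf _ wR \<alpha>(2) w' far far f f])
    qed
    from spectral_distribution_le[OF fin fin sa sa \<rho> W(2) R'W this, of t] R'c
    show ?thesis by linarith
  qed
  show "\<exists>M. \<forall>x\<in>UNIV. \<forall>m\<ge>M. \<forall>n\<ge>M. dist (spectral_distribution (V (G m)) (B m) x)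
      (spectral_distribution (V (G n)) (B n) x) < e"
  proof (intro exI[of _ "max M N"] ballI allI impI)
    fix t :: real and m n assume mn: "m \<ge> max M N" "n \<ge> max M N"
    show "dist (spectral_distribution (V (G m)) (B m) t) (spectral_distribution (V (G n)) (B n) t) < e"
      using le[OF mn, of t] le[OF mn(2,1), of t] e by (simp add: dist_real_def c_def abs_less_iff)
  qed
qed

end
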